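(* Let $p=p(a,x)\in\mathbb R\langle a,x\rangle$ be a symmetric polynomial of degree $d$, of degree $d_a$ in $a$ and degree $d_x$ in $x$. Suppose $n\ge N(g,d)$, $v\in\mathbb R^n$, $\chi\in\mathbb S_n(\mathbb R^g)$, and that $U$ is a nonempty open set in $\mathbb S_n(\mathbb R^g)$. If (i) for each $A\in U$, the family $\{m(A,\chi)v\}$, indexed by the monomials $m$ in $(a,x)$ with $\deg_x m\le d_x-2$ and $\deg_a m\le d_a$, is linearly independent in $\mathbb R^n$; and (ii) for each natural number $\ell$ and each $A\in U$, $$0\le\Big\langle\frac{\partial^2}{\partial x^2}p(A\otimes I_\ell,\chi\otimes I_\ell)[H]\,[v]_\ell,[v]_\ell\Big\rangle\quad\text{for all }H\in\mathbb S_{n\ell}(\mathbb R^g),$$ then (a) the degree of $p$ in $x$ is at most two; (b) the partial Hessian of $p$ takes the form $\frac{\partial^2}{\partial x^2}p(a,x)[h]=(V(a)[h])^TZ_{0,0}(a)V(a)[h]$; (c) $Z_{0,0}(A)\succeq0$ for $A\in U$; and (d) there is a symmetric polynomial $L(a,x)$ which has degree at most one in $x$ such that $$p(a,x)=\tfrac12V(a)[x]^TZ_{0,0}(a)V(a)[x]+L(a,x).$$ In particular, $p(A,X)$ is (globally) convex in $X\in\mathbb S_n(\mathbb R^g)$ for each fixed $A\in U$.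
   Context: Fix a positive integer $g$. $\mathbb R\langle a,x\rangle$ denotes the polynomials with real coefficients in the non-commuting variables $a=(a_1,\dots,a_g)$, $x=(x_1,\dots,x_g)$. The involution ${}^T$ is linear, reverses the order of words, and fixes each variable; $p$ is symmetric if $p^T=p$; for matrices of polynomials ${}^T$ is the matrix transpose combined with the involution entrywise. $\mathbb S_n(\mathbb R^g)$ is the set of $g$-tuples of real symmetric $n\times n$ matrices; polynomials are evaluated at such tuples by substitution. $P\succeq0$ means symmetric positive semidefinite. $N(g,d)=\sum_{j=0}^d g^j$. For a tuple $A\in\mathbb S_n(\mathbb R^g)$, $A\otimes I_\ell\in\mathbb S_{n\ell}(\mathbb R^g)$ is the tuple of direct sums of $\ell$ copies of each $A_j$, acting on $\mathbb R^{n\ell}=(\mathbb R^n)^\ell$, and $[v]_\ell\in(\mathbb R^n)^\ell$ is the vector each of whose $\ell$ blocks equals $v$. The partial Hessian $\frac{\partial^2}{\partial x^2}p(a,x)[h]$, $h=(h_1,\dots,h_g)$ additional non-commuting symmetric variables, is the formal second derivative at $t=0$ of $t\mapsto p(a,x+th)$; it is homogeneous of degree two in $h$. $V(a)[h]$ denotes the column vector whose entries are the words $h_jm(a)$ with $1\le j\le g$ and $m$ a word in $a$ of degree at most $d_a$; $V(a)[x]$ is obtained by replacing $h$ with $x$. The partial Hessian has a unique representation $\sum_{u,w}u^TZ_{u,w}(a,x)\,w$, where $u,w$ run over the words $h_jm(a,x)$ with $m$ a word of degree at most $d_a$ in $a$ and at most $d_x-2$ in $x$, and the $Z_{u,w}$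 are polynomials in $(a,x)$; $Z=(Z_{u,w})$ is its (symmetric) middle matrix. $Z_{0,0}$ is the block of $Z$ with row and column indices $u,w$ among the entries of $V(a)[h]$ (words containing no $x$); conclusion (b) includes that this block depends only on $a$. Globally convex in $X$ means $tp(A,X)+(1-t)p(A,Y)-p(A,tX+(1-t)Y)\succeq0$ for all $X,Y\in\mathbb S_n(\mathbb R^g)$ and $0<t<1$. *)

theory Defs
  imports
    "HOL-Analysis.Derivative"
    "HOL-Library.Poly_Mapping"
    "Jordan_Normal_Form.Matrix"
begin

section \<open>Non-commutative polynomials\<close>

text \<open>
  Words are lists of letters. With concatenation as addition, the convolution product of
  \<^theory>\<open>HOL-Library.Poly_Mapping\<close> turns finitely supported real functions on words into the free
  algebra.
\<close>

instantiation list :: (type) monoid_add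
begin
definition plus_list :: "'a list \<Rightarrow> 'a list \<Rightarrow> 'a list" where
  "plus_list u w = u @ w"
definition zero_list :: "'a list" where
  "zero_list = []"
instance
  by standard (simp_all add: plus_list_def zero_list_def)
end

type_synonym 'v ncpoly = "'v list \<Rightarrow>\<^sub>0 real"

definition nc_const :: "real \<Rightarrow> 'v ncpoly" where
  "nc_const c = Poly_Mapping.single [] c"

definition nc_mono :: "'v list \<Rightarrow> 'v ncpoly" where
  "nc_mono w = Poly_Mapping.single w 1"

definition ncpolys :: "'v set \<Rightarrow> 'v ncpoly set" where
  "ncpolys V = {p. Poly_Mapping.keys p \<subseteq> lists V}"

definition nct :: "'v ncpoly \<Rightarrow> 'v ncpoly" where
  "nct p = Poly_Mapping.map_key rev p"

definition wdeg :: "'v set \<Rightarrow> 'v list \<Rightarrow> nat" where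
  "wdeg S w = length (filter (\<lambda>v. v \<in> S) w)"

text \<open>Degree in the letters from \<open>S\<close>; the zero polynomial has degree \<open>0\<close>.\<close>

definition pdeg :: "'v set \<Rightarrow> 'v ncpoly \<Rightarrow> nat" where
  "pdeg S p = Max (insert 0 (wdeg S ` Poly_Mapping.keys p))"

definition nc_subst :: "('v \<Rightarrow> 'w ncpoly) \<Rightarrow> 'v ncpoly \<Rightarrow> 'w ncpoly" where
  "nc_subst \<sigma> p =
    (\<Sum>w\<in>Poly_Mapping.keys p. nc_const (Poly_Mapping.lookup p w) * prod_list (map \<sigma> w))"

text \<open>
  The three classes of variables \<open>a\<close>, \<open>x\<close>, \<open>h\<close>, each indexed by a finite (automatically nonempty)
  type \<open>'g\<close> with \<open>g = CARD('g)\<close>. The polynomials in \<open>(a,x)\<close> are \<open>ncpolys (avars \<union> xvars)\<close>.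
\<close>

datatype 'g var = Avar 'g | Xvar 'g | Hvar 'g

abbreviation avars :: "'g var set" where "avars \<equiv> range Avar"
abbreviation xvars :: "'g var set" where "xvars \<equiv> range Xvar"

section \<open>Partial Hessian and middle matrix\<close>

fun shift_var :: "real \<Rightarrow> 'g var \<Rightarrow> 'g var ncpoly" where
  "shift_var t (Avar j) = nc_mono [Avar j]"
| "shift_var t (Xvar j) = nc_mono [Xvar j] + nc_const t * nc_mono [Hvar j]"
| "shift_var t (Hvar j) = nc_mono [Hvar j]"

text \<open>
  The second derivative at \<open>t = 0\<close> of \<open>t \<mapsto> p(a, x + t h)\<close>, taken coefficient by coefficient. The
  finite support needed for \<open>Abs_poly_mapping\<close> is established in \<open>lookup_partial_hessian\<close> below.
\<close>

definition partial_hessian :: "'g var ncpoly \<Rightarrow> 'g var ncpoly" where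
  "partial_hessian p = Poly_Mapping.Abs_poly_mapping
    (\<lambda>w. (deriv ^^ 2) (\<lambda>t. Poly_Mapping.lookup (nc_subst (shift_var t) p) w) 0)"

text \<open>
  \<open>sandwich I e M\<close> is \<open>E\<^sup>T M E\<close> for the column \<open>E\<close> with entries \<open>e u\<close>, \<open>u \<in> I\<close>.
\<close>

definition sandwich ::
  "'i set \<Rightarrow> ('i \<Rightarrow> 'v ncpoly) \<Rightarrow> ('i \<Rightarrow> 'i \<Rightarrow> 'v ncpoly) \<Rightarrow> 'v ncpoly" where
  "sandwich I e M = (\<Sum>u\<in>I. \<Sum>w\<in>I. nct (e u) * M u w * e w)"

text \<open>
  Monomials \<open>m(a,x)\<close> of degree at most \<open>d\<^sub>a\<close> in \<open>a\<close> and at most \<open>d\<^sub>x - 2\<close> in \<open>x\<close>. There are none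
  if \<open>d\<^sub>x < 2\<close>, hence no truncated subtraction.
\<close>

definition border_monos :: "nat \<Rightarrow> nat \<Rightarrow> 'g var list set" where
  "border_monos da dx =
    {m \<in> lists (avars \<union> xvars). wdeg avars m \<le> da \<and> wdeg xvars m + 2 \<le> dx}"

definition border :: "nat \<Rightarrow> nat \<Rightarrow> 'g var list set" where
  "border da dx = {Hvar j # m | j m. m \<in> border_monos da dx}"

text \<open>The index set of \<open>V(a)[h]\<close>, whose entries are the words themselves.\<close>

definition border0 :: "nat \<Rightarrow> 'g var list set" where
  "border0 da = {Hvar j # m | j m. m \<in> lists avars \<and> length m \<le> da}"

fun h_to_x :: "'g var \<Rightarrow> 'g var" where
  "h_to_x (Avar j) = Avar j"
| "h_to_x (Xvar j) = Xvar j"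
| "h_to_x (Hvar j) = Xvar j"

abbreviation (input) V_h :: "'g var list \<Rightarrow> 'g var ncpoly" where
  "V_h w \<equiv> nc_mono w"

abbreviation (input) V_x :: "'g var list \<Rightarrow> 'g var ncpoly" where
  "V_x w \<equiv> nc_mono (map h_to_x w)"

text \<open>
  A middle matrix is a matrix indexed by \<open>border\<close>; it is extended by \<open>0\<close> outside. So \<open>Z\<^sub>0\<^sub>0\<close>, the
  restriction to \<open>border0\<close>, is the zero matrix in the degenerate case \<open>d\<^sub>x < 2\<close>, where \<open>border\<close> is
  empty and the Hessian vanishes.
\<close>

definition is_middle_matrix ::
  "'g var ncpoly \<Rightarrow> ('g var list \<Rightarrow> 'g var list \<Rightarrow> 'g var ncpoly) \<Rightarrow> bool" where
  "is_middle_matrix p Z \<longleftrightarrow>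
    (let B = border (pdeg avars p) (pdeg xvars p) in
      (\<forall>u w. u \<notin> B \<or> w \<notin> B \<longrightarrow> Z u w = 0) \<and>
      (\<forall>u\<in>B. \<forall>w\<in>B. Z u w \<in> ncpolys (avars \<union> xvars)) \<and>
      partial_hessian p = sandwich B nc_mono Z)"

definition middle_matrix ::
  "'g var ncpoly \<Rightarrow> 'g var list \<Rightarrow> 'g var list \<Rightarrow> 'g var ncpoly" where
  "middle_matrix p = (THE Z. is_middle_matrix p Z)"

subsection \<open>Existence and uniqueness of the middle matrix\<close>

lemma lookup_nc_const_mult: "Poly_Mapping.lookup (nc_const c * p) w = c * Poly_Mapping.lookup p w"
proof -
  have "nc_const c * p = Poly_Mapping.map ((*) c) p"
    by (simp add: nc_const_def mult_map_scale_conv_mult zero_list_def)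
  then show ?thesis
    by (simp add: Poly_Mapping.map.rep_eq when_def)
qed

lemma lookup_nc_mono_mult:
  "Poly_Mapping.lookup (nc_mono u * p) w =
    (if take (length u) w = u then Poly_Mapping.lookup p (drop (length u) w) else 0)"
proof -
  have eq: "w = u @ q \<longleftrightarrow> take (length u) w = u \<and> q = drop (length u) w" for q
    by (metis append_eq_conv_conj)
  have "Poly_Mapping.lookup (nc_mono u * p) w =
      Sum_any (\<lambda>q. Poly_Mapping.lookup p q when w = u @ q)"
    by (simp add: lookup_mult nc_mono_def lookup_single when_mult plus_list_def)
  also have "\<dots> = Sum_any (\<lambda>q.
      (Poly_Mapping.lookup p q when take (length u) w = u) when q = drop (length u) w)"
    by (simp add: eq when_def conj_commute cong: if_cong)
  also have "\<dots> = (if take (length u) w = u then Poly_Mapping.lookup p (drop (length u) w) else 0)"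
    by (simp add: when_def)
  finally show ?thesis .
qed

lemma lookup_mult_nc_mono:
  "Poly_Mapping.lookup (p * nc_mono u) w = Sum_any (\<lambda>l. Poly_Mapping.lookup p l when w = l @ u)"
proof -
  have "Sum_any (\<lambda>q. ((1::real) when u = q) when w = l @ q) = (1 when w = l @ u)" for l
  proof -
    have "Sum_any (\<lambda>q. ((1::real) when u = q) when w = l @ q)
        = Sum_any (\<lambda>q. ((1::real) when w = l @ u) when q = u)"
      by (rule Sum_any.cong) (auto simp: when_def)
    then show ?thesis by simp
  qed
  then show ?thesis
    by (simp add: lookup_mult nc_mono_def lookup_single plus_list_def mult_when)
qed

lemma lookup_mult_nc_mono_append:
  "Poly_Mapping.lookup (p * nc_mono u) (s @ u) = Poly_Mapping.lookup p s"
proof -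
  have "Sum_any (\<lambda>l. Poly_Mapping.lookup p l when s @ u = l @ u)
      = Sum_any (\<lambda>l. Poly_Mapping.lookup p l when l = s)"
    by (rule Sum_any.cong) (auto simp: when_def)
  then show ?thesis
    by (simp add: lookup_mult_nc_mono)
qed

lemma lookup_mult_nc_mono_nz:
  assumes "Poly_Mapping.lookup (p * nc_mono u) w \<noteq> 0"
  shows "\<exists>s. w = s @ u \<and> Poly_Mapping.lookup p s \<noteq> 0"
  using assms unfolding lookup_mult_nc_mono
  by (auto elim!: Sum_any.not_neutral_obtains_not_neutral simp: when_def split: if_splits)

lemma lookup_nc_mono_mult_nc_mono:
  "Poly_Mapping.lookup (nc_mono u * p * nc_mono w) (u @ s @ w) = Poly_Mapping.lookup p s"
  by (metis append_assoc append_eq_conv_conj lookup_mult_nc_mono_append lookup_nc_mono_mult)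

lemma lookup_nc_mono_mult_nc_mono_nz:
  assumes "Poly_Mapping.lookup (nc_mono u * p * nc_mono w) z \<noteq> 0"
  shows "\<exists>s. z = u @ s @ w \<and> Poly_Mapping.lookup p s \<noteq> 0"
proof -
  obtain y where y: "z = y @ w" "Poly_Mapping.lookup (nc_mono u * p) y \<noteq> 0"
    using lookup_mult_nc_mono_nz[OF assms] by auto
  then have "take (length u) y = u" "Poly_Mapping.lookup p (drop (length u) y) \<noteq> 0"
    by (auto simp: lookup_nc_mono_mult split: if_splits)
  with y show ?thesis
    by (metis append_assoc append_take_drop_id)
qed

lemma lookup_nct: "Poly_Mapping.lookup (nct p) w = Poly_Mapping.lookup p (rev w)"
  by (simp add: nct_def Poly_Mapping.map_key.rep_eq inj_on_def)

lemma nct_nc_mono: "nct (nc_mono u) = nc_mono (rev u)"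
  by (rule poly_mapping_eqI) (auto simp: lookup_nct nc_mono_def lookup_single when_def)

lemma lookup_prod_shift_var:
  assumes "u \<in> lists (avars \<union> xvars)"
  shows "Poly_Mapping.lookup (prod_list (map (shift_var t) u)) z =
    (if map h_to_x z = u then t ^ wdeg (range Hvar) z else 0)"
  using assms
proof (induction u arbitrary: z rule: lists.induct)
  case Nil
  then show ?case
    by (auto simp: lookup_one zero_list_def when_def wdeg_def)
next
  case (Cons v u)
  have IH: "Poly_Mapping.lookup (prod_list (map (shift_var t) u)) z =
      (if map h_to_x z = u then t ^ wdeg (range Hvar) z else 0)" for z
    using Cons by auto
  have *: "Poly_Mapping.lookup (nc_mono [y] * q) z =
      (case z of [] \<Rightarrow> 0 | y' # z' \<Rightarrow> if y' = y then Poly_Mapping.lookup q z' else 0)"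
    for y z and q :: "'a var ncpoly"
    by (auto simp: lookup_nc_mono_mult split: list.split)
  consider (A) j where "v = Avar j" | (X) j where "v = Xvar j"
  proof -
    have "v \<in> avars \<union> xvars" using Cons.hyps by simp
    then show thesis using that by blast
  qed
  then show ?case
  proof cases
    case A
    show ?thesis
    proof (cases z)
      case (Cons y z')
      then show ?thesis
        by (cases y) (auto simp: A * IH wdeg_def)
    qed (simp add: A *)
  next
    case X
    show ?thesis
    proof (cases z)
      case (Cons y z')
      then show ?thesis
        by (cases y) (auto simp: X * IH wdeg_def distrib_right lookup_add mult.assoc
            lookup_nc_const_mult)
    qed (simp add: X * distrib_right lookup_add mult.assoc lookup_nc_const_mult)
  qed
qed

lemma lookup_subst_shift_var:
  assumes "p \<in> ncpolys (avars \<union> xvars)"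
  shows "Poly_Mapping.lookup (nc_subst (shift_var t) p) z =
    Poly_Mapping.lookup p (map h_to_x z) * t ^ wdeg (range Hvar) z"
proof -
  have "Poly_Mapping.lookup (nc_subst (shift_var t) p) z =
      (\<Sum>u\<in>Poly_Mapping.keys p. Poly_Mapping.lookup p u *
        (if map h_to_x z = u then t ^ wdeg (range Hvar) z else 0))"
    unfolding nc_subst_def lookup_sum lookup_nc_const_mult
    using assms by (intro sum.cong refl) (auto simp: ncpolys_def lookup_prod_shift_var subset_iff)
  also have "\<dots> = (\<Sum>u\<in>Poly_Mapping.keys p.
      if map h_to_x z = u then Poly_Mapping.lookup p u * t ^ wdeg (range Hvar) z else 0)"
    by (intro sum.cong) auto
  also have "\<dots> = Poly_Mapping.lookup p (map h_to_x z) * t ^ wdeg (range Hvar) z"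
    by (subst sum.delta') (auto simp: in_keys_iff)
  finally show ?thesis .
qed

lemma deriv2_monomial_0:
  "(deriv ^^ 2) (\<lambda>t::real. c * t ^ k) 0 = (if k = 2 then 2 * c else 0)"
proof -
  have d: "deriv (\<lambda>t::real. e * t ^ m) = (\<lambda>t. (e * real m) * t ^ (m - 1))" for e m
    by (rule ext, rule DERIV_imp_deriv) (auto intro!: derivative_eq_intros)
  have "(deriv ^^ 2) (\<lambda>t::real. c * t ^ k) = deriv (deriv (\<lambda>t. c * t ^ k))"
    by (simp add: numeral_2_eq_2)
  also have "\<dots> = (\<lambda>t. c * real k * real (k - 1) * t ^ (k - 1 - 1))"
    unfolding d by (rule refl)
  finally have e: "(deriv ^^ 2) (\<lambda>t::real. c * t ^ k) =
      (\<lambda>t. c * real k * real (k - 1) * t ^ (k - 1 - 1))" .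
  consider "k = 0" | "k = 1" | "k = 2" | m where "k = Suc (Suc (Suc m))"
    by (metis One_nat_def Suc_1 not0_implies_Suc)
  then show ?thesis
    unfolding e by cases simp_all
qed

lemma lookup_partial_hessian:
  fixes p :: "'g::finite var ncpoly"
  assumes p: "p \<in> ncpolys (avars \<union> xvars)"
  shows "Poly_Mapping.lookup (partial_hessian p) z =
    (deriv ^^ 2) (\<lambda>t. Poly_Mapping.lookup (nc_subst (shift_var t) p) z) 0" (is ?thesis1)
    and "Poly_Mapping.lookup (partial_hessian p) z =
    (if wdeg (range Hvar) z = 2 then 2 * Poly_Mapping.lookup p (map h_to_x z) else 0)" (is ?thesis2)
proof -
  define f where "f = (\<lambda>z. (deriv ^^ 2) (\<lambda>t. Poly_Mapping.lookup (nc_subst (shift_var t) p) z) 0)"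
  have f: "f z = (if wdeg (range Hvar) z = 2 then 2 * Poly_Mapping.lookup p (map h_to_x z) else 0)"
    for z
    by (simp add: f_def lookup_subst_shift_var[OF p] deriv2_monomial_0)
  have UNIV_var: "(UNIV :: 'g var set) = avars \<union> xvars \<union> range Hvar"
    by (auto, metis rangeI var.exhaust)
  have fin: "finite (UNIV :: 'g var set)"
    unfolding UNIV_var by (intro finite_UnI finite_imageI finite)
  have "{z. f z \<noteq> 0} \<subseteq> (\<Union>u\<in>Poly_Mapping.keys p. {z. set z \<subseteq> UNIV \<and> length z = length u})"
  proof
    fix z assume "z \<in> {z. f z \<noteq> 0}"
    then have "map h_to_x z \<in> Poly_Mapping.keys p"
      by (auto simp: f in_keys_iff split: if_splits)
    then show "z \<in> (\<Union>u\<in>Poly_Mapping.keys p. {z. set z \<subseteq> UNIV \<and> length z = length u})"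
      by (intro UN_I[of "map h_to_x z"]) auto
  qed
  moreover have "finite \<dots>"
    by (intro finite_UN_I finite_keys finite_lists_length_eq fin)
  ultimately have "finite {z. f z \<noteq> 0}"
    by (rule finite_subset)
  then have "Poly_Mapping.lookup (partial_hessian p) z = f z"
    unfolding partial_hessian_def f_def[symmetric] by simp
  then show ?thesis1 ?thesis2
    using f by (simp_all add: f_def)
qed

lemma split_first_unique:
  assumes "\<forall>v\<in>set m. \<not> P v" "\<forall>v\<in>set m'. \<not> P v" "P x" "P x'" "m @ x # r = m' @ x' # r'"
  shows "m = m' \<and> x = x' \<and> r = r'"
  using assms
proof (induction m arbitrary: m')
  case Nil
  then show ?case by (cases m') auto
next
  case (Cons a m)
  then show ?case by (cases m') auto
qed

lemma finite_border: "finite (border da dx :: 'g::finite var list set)"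
proof -
  have wd: "length m = wdeg avars m + wdeg xvars m" if "m \<in> lists (avars \<union> xvars)"
    for m :: "'g var list"
    using that by (induction m) (auto simp: wdeg_def)
  have "(border_monos da dx :: 'g var list set) \<subseteq> {m. set m \<subseteq> avars \<union> xvars \<and> length m \<le> da + dx}"
  proof
    fix m :: "'g var list" assume "m \<in> border_monos da dx"
    then show "m \<in> {m. set m \<subseteq> avars \<union> xvars \<and> length m \<le> da + dx}"
      using wd[of m] by (auto simp: border_monos_def)
  qed
  moreover have "finite {m :: 'g var list. set m \<subseteq> avars \<union> xvars \<and> length m \<le> da + dx}"
    by (intro finite_lists_length_le) auto
  ultimately have "finite (border_monos da dx :: 'g var list set)"
    by (rule finite_subset)
  moreover have "(border da dx :: 'g var list set) =
      (\<lambda>(j, m). Hvar j # m) ` (UNIV \<times> border_monos da dx)"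
    by (auto simp: border_def)
  ultimately show ?thesis
    by simp
qed

lemma border_split_unique:
  assumes "u \<in> border da dx" "w \<in> border da dx" "s \<in> lists (avars \<union> xvars)"
    and "u' \<in> border da dx" "w' \<in> border da dx" "s' \<in> lists (avars \<union> xvars)"
    and eq: "rev u @ s @ w = rev u' @ s' @ w'"
  shows "u = u' \<and> s = s' \<and> w = w'"
proof -
  let ?P = "\<lambda>v. v \<in> range Hvar"
  obtain i m where u: "u = Hvar i # m" "m \<in> lists (avars \<union> xvars)"
    using assms(1) by (auto simp: border_def border_monos_def)
  obtain j k where w: "w = Hvar j # k" "k \<in> lists (avars \<union> xvars)"
    using assms(2) by (auto simp: border_def border_monos_def)
  obtain i' m' where u': "u' = Hvar i' # m'" "m' \<in> lists (avars \<union> xvars)"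
    using assms(4) by (auto simp: border_def border_monos_def)
  obtain j' k' where w': "w' = Hvar j' # k'" "k' \<in> lists (avars \<union> xvars)"
    using assms(5) by (auto simp: border_def border_monos_def)
  have noH: "\<forall>v\<in>set l. \<not> ?P v" if "l \<in> lists (avars \<union> xvars)" for l
    using that by auto
  have "rev m = rev m' \<and> Hvar i = Hvar i' \<and> s @ w = s' @ w'"
    using eq noH[OF u(2)] noH[OF u'(2)] by (intro split_first_unique[where P = ?P]) (auto simp: u u')
  moreover from this have "s = s' \<and> Hvar j = Hvar j' \<and> k = k'"
    using noH[OF assms(3)] noH[OF assms(6)]
    by (intro split_first_unique[where P = ?P]) (auto simp: w w')
  ultimately show ?thesis
    by (simp add: u u' w w')
qed

lemma lookup_sandwich_border:
  fixes Z :: "'g::finite var list \<Rightarrow> 'g var list \<Rightarrow> 'g var ncpoly"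
  assumes Z: "\<forall>u\<in>border da dx. \<forall>w\<in>border da dx. Z u w \<in> ncpolys (avars \<union> xvars)"
    and uw: "u \<in> border da dx" "w \<in> border da dx" and s: "s \<in> lists (avars \<union> xvars)"
  shows "Poly_Mapping.lookup (sandwich (border da dx) nc_mono Z) (rev u @ s @ w) =
    Poly_Mapping.lookup (Z u w) s"
proof -
  let ?B = "border da dx :: 'g var list set" and ?z = "rev u @ s @ w"
  have "Poly_Mapping.lookup (nc_mono (rev u') * Z u' w' * nc_mono w') ?z =
      (if u' = u then if w' = w then Poly_Mapping.lookup (Z u w) s else 0 else 0)"
    if B: "u' \<in> ?B" "w' \<in> ?B" for u' w'
  proof (cases "u' = u \<and> w' = w")
    case False
    have "Poly_Mapping.lookup (nc_mono (rev u') * Z u' w' * nc_mono w') ?z = 0"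
    proof (rule ccontr)
      assume "\<not> ?thesis"
      then obtain s' where s': "?z = rev u' @ s' @ w'" "Poly_Mapping.lookup (Z u' w') s' \<noteq> 0"
        using lookup_nc_mono_mult_nc_mono_nz by blast
      then have "s' \<in> lists (avars \<union> xvars)"
        using Z B by (auto simp: ncpolys_def in_keys_iff subset_iff)
      with border_split_unique[OF uw s B this s'(1)] False show False
        by auto
    qed
    with False show ?thesis by auto
  qed (auto simp: lookup_nc_mono_mult_nc_mono)
  then have "Poly_Mapping.lookup (sandwich ?B nc_mono Z) ?z =
      (\<Sum>u'\<in>?B. \<Sum>w'\<in>?B. if u' = u then if w' = w then Poly_Mapping.lookup (Z u w) s else 0 else 0)"
    by (auto simp: sandwich_def lookup_sum nct_nc_mono intro!: sum.cong)
  also have "\<dots> = (\<Sum>u'\<in>?B. if u' = u then \<Sum>w'\<in>?B. if w' = w then Poly_Mapping.lookup (Z u w) s else 0 else 0)"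
    by (intro sum.cong) auto
  also have "\<dots> = Poly_Mapping.lookup (Z u w) s"
    using uw by (simp add: finite_border)
  finally show ?thesis .
qed

lemma hessian_key_split:
  fixes p :: "'g::finite var ncpoly"
  assumes p: "p \<in> ncpolys (avars \<union> xvars)"
    and nz: "Poly_Mapping.lookup (partial_hessian p) z \<noteq> 0"
  shows "\<exists>u\<in>border (pdeg avars p) (pdeg xvars p). \<exists>w\<in>border (pdeg avars p) (pdeg xvars p).
    \<exists>s\<in>lists (avars \<union> xvars). z = rev u @ s @ w"
proof -
  let ?H = "\<lambda>v. v \<in> range (Hvar :: 'g \<Rightarrow> _)"
  have two: "length (filter ?H z) = Suc (Suc 0)" and key: "map h_to_x z \<in> Poly_Mapping.keys p"
    using nz by (auto simp: lookup_partial_hessian(2)[OF p] in_keys_iff wdeg_def split: if_splits)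
  have ax: "v \<in> avars \<union> xvars" if "\<not> ?H v" for v :: "'g var"
    using that by (cases v) auto
  have noH: "l \<in> lists (avars \<union> xvars)" if "\<forall>v\<in>set l. \<not> ?H v" for l :: "'g var list"
    using that ax by (simp add: in_lists_conv_set)
  obtain x xs where "filter ?H z = x # xs" and xs: "length xs = Suc 0"
    using two by (cases "filter ?H z") auto
  then obtain m r where m: "z = m @ x # r" "\<forall>v\<in>set m. \<not> ?H v" "?H x" "filter ?H r = xs"
    by (auto simp: filter_eq_Cons_iff)
  obtain y where "xs = [y]"
    using xs by (cases xs) auto
  then obtain s k where s: "r = s @ y # k" "\<forall>v\<in>set s. \<not> ?H v" "?H y" "filter ?H k = []"
    using m(4) by (auto simp: filter_eq_Cons_iff)
  then have k: "\<forall>v\<in>set k. \<not> ?H v"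
    by (auto simp: filter_empty_conv)
  obtain i j where ij: "x = Hvar i" "y = Hvar j"
    using m(3) s(3) by auto
  have le: "wdeg S (map h_to_x z) \<le> pdeg S p" for S
    unfolding pdeg_def using key by (intro Max_ge) auto
  have h: "map h_to_x l = l" if "l \<in> lists (avars \<union> xvars)" for l :: "'g var list"
    using that by (induction l) auto
  have eq: "map h_to_x z = m @ Xvar i # s @ Xvar j # k"
    using h[OF noH] m(1,2) s(1,2) k ij by simp
  have "wdeg avars (rev m) \<le> pdeg avars p" "wdeg avars k \<le> pdeg avars p"
    "wdeg xvars (rev m) + 2 \<le> pdeg xvars p" "wdeg xvars k + 2 \<le> pdeg xvars p"
    using le[of avars] le[of xvars]
    by (simp_all add: eq wdeg_def rev_filter[symmetric] image_iff del: filter.simps(2)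
        add: filter.simps(2))
  then have "Hvar i # rev m \<in> border (pdeg avars p) (pdeg xvars p)"
    "Hvar j # k \<in> border (pdeg avars p) (pdeg xvars p)"
    using noH[OF m(2)] noH[OF k] by (auto simp: border_def border_monos_def)
  moreover have "z = rev (Hvar i # rev m) @ s @ Hvar j # k"
    by (simp add: m(1) s(1) ij)
  ultimately show ?thesis
    using noH[OF s(2)] by blast
qed

theorem ex1_middle_matrix:
  fixes p :: "'g::finite var ncpoly"
  assumes p: "p \<in> ncpolys (avars \<union> xvars)"
  shows "\<exists>!Z. is_middle_matrix p Z"
proof (rule ex_ex1I)
  define B where "B = (border (pdeg avars p) (pdeg xvars p) :: 'g var list set)"
  define f where "f = (\<lambda>u w s. if u \<in> B \<and> w \<in> B \<and> s \<in> lists (avars \<union> xvars)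
    then Poly_Mapping.lookup (partial_hessian p) (rev u @ s @ w) else 0)"
  define Z where "Z = (\<lambda>u w. Poly_Mapping.Abs_poly_mapping (f u w))"
  have Z: "Poly_Mapping.lookup (Z u w) s = f u w s" for u w s
  proof -
    have "{s. f u w s \<noteq> 0} \<subseteq> (\<lambda>s. rev u @ s @ w) -` Poly_Mapping.keys (partial_hessian p)"
      by (auto simp: f_def in_keys_iff split: if_splits)
    moreover have "finite \<dots>"
      by (intro finite_vimageI finite_keys) (auto simp: inj_on_def)
    ultimately have "finite {s. f u w s \<noteq> 0}"
      by (rule finite_subset)
    then show ?thesis
      by (simp add: Z_def)
  qed
  have 1: "\<forall>u w. u \<notin> B \<or> w \<notin> B \<longrightarrow> Z u w = 0"
    by (auto intro!: poly_mapping_eqI simp: Z f_def)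
  have 2: "\<forall>u\<in>B. \<forall>w\<in>B. Z u w \<in> ncpolys (avars \<union> xvars)"
    by (auto simp: ncpolys_def in_keys_iff Z f_def split: if_splits)
  have 3: "partial_hessian p = sandwich B nc_mono Z"
  proof (rule poly_mapping_eqI)
    fix z
    show "Poly_Mapping.lookup (partial_hessian p) z = Poly_Mapping.lookup (sandwich B nc_mono Z) z"
    proof (cases "\<exists>u\<in>B. \<exists>w\<in>B. \<exists>s\<in>lists (avars \<union> xvars). z = rev u @ s @ w")
      case True
      then obtain u w s where *: "u \<in> B" "w \<in> B" "s \<in> lists (avars \<union> xvars)" "z = rev u @ s @ w"
        by blast
      then have "Poly_Mapping.lookup (sandwich B nc_mono Z) z = Poly_Mapping.lookup (Z u w) s"
        using lookup_sandwich_border[of "pdeg avars p" "pdeg xvars p" Z u w s] 2 by (simp add: B_def)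
      then show ?thesis
        using * by (simp add: Z f_def)
    next
      case False
      then have "Poly_Mapping.lookup (partial_hessian p) z = 0"
        using hessian_key_split[OF p] unfolding B_def by blast
      moreover have "Poly_Mapping.lookup (nc_mono (rev u) * Z u w * nc_mono w) z = 0"
        if "u \<in> B" "w \<in> B" for u w
      proof (rule ccontr)
        assume "\<not> ?thesis"
        then obtain s where s: "z = rev u @ s @ w" "Poly_Mapping.lookup (Z u w) s \<noteq> 0"
          using lookup_nc_mono_mult_nc_mono_nz by blast
        then have "s \<in> lists (avars \<union> xvars)"
          unfolding Z f_def by metis
        with that s(1) False show False by blast
      qed
      ultimately show ?thesis
        by (simp add: sandwich_def lookup_sum nct_nc_mono)
    qed
  qed
  show "\<exists>Z. is_middle_matrix p Z"
    using 1 2 3 unfolding is_middle_matrix_def Let_def B_def by blast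
next
  fix Y Z
  assume Y: "is_middle_matrix p Y" and Z: "is_middle_matrix p Z"
  define B where "B = (border (pdeg avars p) (pdeg xvars p) :: 'g var list set)"
  have D: "M u w = 0 \<or> u \<in> B \<and> w \<in> B" "\<forall>u\<in>B. \<forall>w\<in>B. M u w \<in> ncpolys (avars \<union> xvars)"
    "partial_hessian p = sandwich B nc_mono M" if "is_middle_matrix p M" for M u w
    using that unfolding is_middle_matrix_def Let_def B_def by blast+
  have "Poly_Mapping.lookup (Y u w) s = Poly_Mapping.lookup (Z u w) s" for u w s
  proof (cases "u \<in> B \<and> w \<in> B \<and> s \<in> lists (avars \<union> xvars)")
    case True
    then have "Poly_Mapping.lookup (M u w) s = Poly_Mapping.lookup (partial_hessian p) (rev u @ s @ w)"
      if "is_middle_matrix p M" for M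
      using lookup_sandwich_border[OF D(2)[OF that, unfolded B_def]]
      unfolding D(3)[OF that] B_def by metis
    with Y Z show ?thesis by simp
  next
    case False
    have "Poly_Mapping.lookup (M u w) s = 0" if M: "is_middle_matrix p M" for M
    proof (cases "u \<in> B \<and> w \<in> B")
      case True
      then have "M u w \<in> ncpolys (avars \<union> xvars)" "s \<notin> lists (avars \<union> xvars)"
        using D(2)[OF M] False by blast+
      then have "s \<notin> Poly_Mapping.keys (M u w)"
        unfolding ncpolys_def by blast
      then show ?thesis
        by (simp add: not_in_keys_iff_lookup_eq_zero)
    next
      case False
      then have "M u w = 0"
        using D(1)[OF M] by blast
      then show ?thesis by simp
    qed
    with Y Z show ?thesis by simp
  qed
  then show "Y = Z"
    by (intro ext poly_mapping_eqI) auto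
qed

lemma is_middle_matrix_middle_matrix:
  fixes p :: "'g::finite var ncpoly"
  assumes "p \<in> ncpolys (avars \<union> xvars)"
  shows "is_middle_matrix p (middle_matrix p)"
  unfolding middle_matrix_def by (rule theI'[OF ex1_middle_matrix[OF assms]])

section \<open>Matrix tuples and evaluation\<close>

definition sym_tuples :: "nat \<Rightarrow> ('g \<Rightarrow> real mat) set" where
  "sym_tuples n = {A. \<forall>j. A j \<in> carrier_mat n n \<and> transpose_mat (A j) = A j}"

text \<open>Open subsets of \<open>sym_tuples n\<close> in its Euclidean topology, via the entrywise maximum norm.\<close>

definition open_tuples :: "nat \<Rightarrow> ('g \<Rightarrow> real mat) set \<Rightarrow> bool" where
  "open_tuples n U \<longleftrightarrow> U \<subseteq> sym_tuples n \<and>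
    (\<forall>A\<in>U. \<exists>\<epsilon>>0. \<forall>B\<in>sym_tuples n.
      (\<forall>j. \<forall>i<n. \<forall>k<n. \<bar>B j $$ (i,k) - A j $$ (i,k)\<bar> < \<epsilon>) \<longrightarrow> B \<in> U)"

definition word_eval :: "nat \<Rightarrow> ('v \<Rightarrow> real mat) \<Rightarrow> 'v list \<Rightarrow> real mat" where
  "word_eval n \<rho> w = foldr (\<lambda>v M. \<rho> v * M) w (1\<^sub>m n)"

definition nc_eval :: "nat \<Rightarrow> ('v \<Rightarrow> real mat) \<Rightarrow> 'v ncpoly \<Rightarrow> real mat" where
  "nc_eval n \<rho> p = mat n n (\<lambda>ij.
    \<Sum>w\<in>Poly_Mapping.keys p. Poly_Mapping.lookup p w * word_eval n \<rho> w $$ ij)"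

fun assign ::
  "('g \<Rightarrow> real mat) \<Rightarrow> ('g \<Rightarrow> real mat) \<Rightarrow> ('g \<Rightarrow> real mat) \<Rightarrow> 'g var \<Rightarrow> real mat" where
  "assign A X H (Avar j) = A j"
| "assign A X H (Xvar j) = X j"
| "assign A X H (Hvar j) = H j"

definition zero_tuple :: "nat \<Rightarrow> 'g \<Rightarrow> real mat" where
  "zero_tuple n = (\<lambda>_. 0\<^sub>m n n)"

text \<open>\<open>p(A,X)\<close> for a polynomial in \<open>(a,x)\<close>; the value assigned to \<open>h\<close> is irrelevant.\<close>

abbreviation eval_ax ::
  "nat \<Rightarrow> 'g var ncpoly \<Rightarrow> ('g \<Rightarrow> real mat) \<Rightarrow> ('g \<Rightarrow> real mat) \<Rightarrow> real mat" where
  "eval_ax n p A X \<equiv> nc_eval n (assign A X (zero_tuple n)) p"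

definition ampl :: "nat \<Rightarrow> ('g \<Rightarrow> real mat) \<Rightarrow> 'g \<Rightarrow> real mat" where
  "ampl l A = (\<lambda>j. diag_block_mat (replicate l (A j)))"

text \<open>The vector consisting of \<open>l\<close> consecutive copies of \<open>v\<close>.\<close>

definition ampl_vec :: "nat \<Rightarrow> real vec \<Rightarrow> real vec" where
  "ampl_vec l v = vec (dim_vec v * l) (\<lambda>i. v $ (i mod dim_vec v))"

definition lin_indep_family :: "nat \<Rightarrow> 'i set \<Rightarrow> ('i \<Rightarrow> real vec) \<Rightarrow> bool" where
  "lin_indep_family n I f \<longleftrightarrow>
    (\<forall>c. finsum_vec TYPE(real) n (\<lambda>i. c i \<cdot>\<^sub>v f i) I = 0\<^sub>v n \<longrightarrow> (\<forall>i\<in>I. c i = 0))"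

definition psd :: "nat \<Rightarrow> real mat \<Rightarrow> bool" where
  "psd n M \<longleftrightarrow> M \<in> carrier_mat n n \<and> transpose_mat M = M \<and>
    (\<forall>\<xi>\<in>carrier_vec n. 0 \<le> scalar_prod (M *\<^sub>v \<xi>) \<xi>)"

text \<open>
  Positive semidefiniteness of the block matrix \<open>(M u w)\<close>, \<open>u, w \<in> I\<close>, with \<open>n \<times> n\<close> blocks,
  acting on the direct sum of copies of \<open>\<real>\<^sup>n\<close> indexed by the finite set \<open>I\<close>.
\<close>

definition block_psd :: "nat \<Rightarrow> 'i set \<Rightarrow> ('i \<Rightarrow> 'i \<Rightarrow> real mat) \<Rightarrow> bool" where
  "block_psd n I M \<longleftrightarrow>
    (\<forall>u\<in>I. \<forall>w\<in>I. M u w \<in> carrier_mat n n \<and> transpose_mat (M u w) = M w u) \<and>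
    (\<forall>\<xi>. (\<forall>u\<in>I. \<xi> u \<in> carrier_vec n) \<longrightarrow>
      0 \<le> (\<Sum>u\<in>I. \<Sum>w\<in>I. scalar_prod (M u w *\<^sub>v \<xi> w) (\<xi> u)))"

definition globally_convex :: "nat \<Rightarrow> (('g \<Rightarrow> real mat) \<Rightarrow> real mat) \<Rightarrow> bool" where
  "globally_convex n f \<longleftrightarrow>
    (\<forall>X\<in>sym_tuples n. \<forall>Y\<in>sym_tuples n. \<forall>t. 0 < t \<and> t < 1 \<longrightarrow>
      psd n (t \<cdot>\<^sub>m f X + (1 - t) \<cdot>\<^sub>m f Y - f (\<lambda>j. t \<cdot>\<^sub>m X j + (1 - t) \<cdot>\<^sub>m Y j)))"

end

theory Submission
  imports Defs "HOL-Computational_Algebra.Polynomial"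
begin

text \<open>
  Positivity of the Hessian form along the single vector \<open>v\<close> is first turned into positivity of the
  whole middle matrix; a degree count and an identity theorem then do the rest.

  The Hessian form on \<open>[v]\<close> is the sum of \<open>\<langle>Z\<^sub>u\<^sub>w w[v], u[v]\<rangle>\<close> over the border words \<open>u\<close>, \<open>w\<close>, and
  \<open>u = h\<^sub>j m\<close> contributes the vector \<open>H\<^sub>j [m(A, \<chi>) v]\<close>. On two copies of \<open>\<real>\<^sup>n\<close> a symmetric \<open>H\<^sub>j\<close> can
  send \<open>(f, f)\<close> to \<open>(T f, - T f)\<close> for any matrix \<open>T\<close> (\<open>ex_symmetric_dilation\<close>), and \<open>T\<close> can take any
  values on the linearly independent vectors \<open>m(A, \<chi>) v\<close> (\<open>ex_interpolating_mat\<close>). Hence the vectors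
  \<open>u[v]\<close> are arbitrary up to the sign pattern, and \<open>Z(A, \<chi>)\<close> is positive semidefinite for \<open>A \<in> U\<close>
  (\<open>block_psd_if_doubled_form_nonneg\<close>).

  If \<open>p\<close> had degree \<open>d\<^sub>x > 2\<close> in \<open>x\<close>, then the diagonal entries of \<open>Z\<close> at the border words of top
  degree would vanish, because a term there would come from a word of \<open>p\<close> of degree at least
  \<open>2 (d\<^sub>x - 2) + 2 > d\<^sub>x\<close> in \<open>x\<close>. A zero diagonal block of a
  positive semidefinite matrix forces a zero row (\<open>block_psd_zero_diagonal\<close>). The entries of that row
  in the columns of \<open>V(a)[h]\<close> are polynomials in \<open>a\<close> that vanish on \<open>U\<close>, and matrices of size larger
  than the degree separate polynomials, even on an open set (\<open>ncpoly_zero_if_zero_on_open\<close>). So these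
  entries are zero, although one of them has a nonzero coefficient from a word of degree \<open>d\<^sub>x\<close> in \<open>p\<close>
  (\<open>pdeg_xvars_le_2_if_block_psd\<close>).

  Once the degree is at most two, \<open>Z\<close> depends on \<open>a\<close> only, so its positivity at \<open>\<chi>\<close> is positivity of
  \<open>Z\<^sub>0\<^sub>0(A)\<close>. The coefficients of \<open>Z\<close> are twice those of \<open>p\<close> (\<open>lookup_middle_matrix\<close>), which makes
  half of \<open>V(a)[x]\<^sup>T Z\<^sub>0\<^sub>0(a) V(a)[x]\<close> the part of \<open>p\<close> of degree two in \<open>x\<close>. The remaining part \<open>L\<close> is
  affine in \<open>X\<close>, so the convexity gap of \<open>p\<close> between \<open>X\<close> and \<open>Y\<close> is \<open>t (1 - t)\<close> times the value of
  the quadratic part at \<open>X - Y\<close> (\<open>nc_eval_convexity_gap\<close>).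
\<close>

lemma sym_tuplesD:
  assumes "A \<in> sym_tuples n"
  shows "A j \<in> carrier_mat n n" and "transpose_mat (A j) = A j"
  using assms by (auto simp: sym_tuples_def)

section \<open>Evaluation on symmetric tuples\<close>

lemma sym_tuplesI:
  assumes "\<And>j. A j \<in> carrier_mat n n"
    and "\<And>j i k. i < n \<Longrightarrow> k < n \<Longrightarrow> A j $$ (i, k) = A j $$ (k, i)"
  shows "A \<in> sym_tuples n"
  using assms carrier_matD[OF assms(1)] by (auto simp: sym_tuples_def intro!: eq_matI)

lemma sym_tuples_index:
  assumes "A \<in> sym_tuples n" "i < n" "k < n"
  shows "A j $$ (i, k) = A j $$ (k, i)"
  using sym_tuplesD[OF assms(1), of j] assms(2,3) by (metis carrier_matD index_transpose_mat(1))

lemma affine_in_sym_tuples: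
  assumes "A \<in> sym_tuples n" "B \<in> sym_tuples n"
  shows "(\<lambda>j. s \<cdot>\<^sub>m A j + t \<cdot>\<^sub>m B j) \<in> sym_tuples n"
proof (rule sym_tuplesI)
  fix j i k assume ik: "i < n" "k < n"
  have "dim_row (A j) = n" "dim_col (A j) = n" "dim_row (B j) = n" "dim_col (B j) = n"
    using sym_tuplesD(1)[OF assms(1), of j] sym_tuplesD(1)[OF assms(2), of j] by auto
  then show "(s \<cdot>\<^sub>m A j + t \<cdot>\<^sub>m B j) $$ (i, k) = (s \<cdot>\<^sub>m A j + t \<cdot>\<^sub>m B j) $$ (k, i)"
    using ik sym_tuples_index[OF assms(1) ik, of j] sym_tuples_index[OF assms(2) ik, of j]
    by simp
qed (use assms in \<open>simp add: sym_tuplesD\<close>)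

lemma assign_in_sym_tuples:
  assumes "A \<in> sym_tuples n" "X \<in> sym_tuples n" "H \<in> sym_tuples n"
  shows "assign A X H \<in> sym_tuples n"
  unfolding sym_tuples_def mem_Collect_eq
proof
  fix v
  show "assign A X H v \<in> carrier_mat n n \<and> transpose_mat (assign A X H v) = assign A X H v"
    using assms by (cases v) (simp_all add: sym_tuplesD)
qed

lemma zero_tuple_in_sym_tuples: "zero_tuple n \<in> sym_tuples n"
  by (simp add: zero_tuple_def sym_tuples_def)

lemma word_eval_Nil [simp]: "word_eval n \<rho> [] = 1\<^sub>m n"
  by (simp add: word_eval_def)

lemma word_eval_Cons [simp]: "word_eval n \<rho> (v # w) = \<rho> v * word_eval n \<rho> w"
  by (simp add: word_eval_def)

lemma word_eval_carrier:
  assumes "\<rho> \<in> sym_tuples n"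
  shows "word_eval n \<rho> w \<in> carrier_mat n n"
proof (induction w)
  case (Cons v w)
  then show ?case
    using sym_tuplesD(1)[OF assms, of v] by simp
qed simp

lemma word_eval_cong:
  assumes "\<And>v. v \<in> set w \<Longrightarrow> \<rho> v = \<sigma> v"
  shows "word_eval n \<rho> w = word_eval n \<sigma> w"
  using assms by (induction w) auto

lemma word_eval_append:
  assumes "\<rho> \<in> sym_tuples n"
  shows "word_eval n \<rho> (u @ w) = word_eval n \<rho> u * word_eval n \<rho> w"
proof (induction u)
  case Nil
  show ?case
    using word_eval_carrier[OF assms, of w] by simp
next
  case (Cons v u)
  show ?case
    using Cons sym_tuplesD(1)[OF assms, of v] word_eval_carrier[OF assms, of u]
      word_eval_carrier[OF assms, of w]
    by (simp add: assoc_mult_mat[of _ n n _ n _ n])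
qed

lemma word_eval_append_mult_vec:
  assumes "\<rho> \<in> sym_tuples n" "\<xi> \<in> carrier_vec n"
  shows "word_eval n \<rho> (u @ w) *\<^sub>v \<xi> = word_eval n \<rho> u *\<^sub>v (word_eval n \<rho> w *\<^sub>v \<xi>)"
  unfolding word_eval_append[OF assms(1)]
  using word_eval_carrier[OF assms(1)] assms(2) by (intro assoc_mult_mat_vec[of _ n n _ n])

lemma word_eval_rev:
  assumes "\<rho> \<in> sym_tuples n"
  shows "word_eval n \<rho> (rev w) = transpose_mat (word_eval n \<rho> w)"
proof (induction w)
  case (Cons v w)
  have "\<rho> v * 1\<^sub>m n = \<rho> v"
    using sym_tuplesD(1)[OF assms, of v] by simp
  then show ?case
    using Cons sym_tuplesD[OF assms, of v] word_eval_carrier[OF assms, of w]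
    by (simp add: word_eval_append[OF assms] transpose_mult[of _ n n])
qed simp

lemma nc_eval_carrier [simp]: "nc_eval n \<rho> p \<in> carrier_mat n n"
  by (simp add: nc_eval_def)

lemma nc_eval_dim [simp]: "dim_row (nc_eval n \<rho> p) = n" "dim_col (nc_eval n \<rho> p) = n"
  by (simp_all add: nc_eval_def)

lemma nc_eval_index:
  assumes "finite S" "Poly_Mapping.keys p \<subseteq> S" "i < n" "k < n"
  shows "nc_eval n \<rho> p $$ (i, k) = (\<Sum>w\<in>S. Poly_Mapping.lookup p w * word_eval n \<rho> w $$ (i, k))"
  using assms by (auto simp: nc_eval_def in_keys_iff intro!: sum.mono_neutral_left)

lemma nc_eval_zero: "nc_eval n \<rho> 0 = 0\<^sub>m n n"
  by (rule eq_matI) (simp_all add: nc_eval_def)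

lemma nc_eval_cong:
  assumes "p \<in> ncpolys V" "\<And>v. v \<in> V \<Longrightarrow> \<rho> v = \<sigma> v"
  shows "nc_eval n \<rho> p = nc_eval n \<sigma> p"
proof -
  have "word_eval n \<rho> w = word_eval n \<sigma> w" if "w \<in> Poly_Mapping.keys p" for w
    using that assms by (intro word_eval_cong) (auto simp: ncpolys_def)
  then show ?thesis
    by (intro eq_matI) (simp_all add: nc_eval_def)
qed

text \<open>
  Quadratic and bilinear forms of matrices are compared through this coordinate formula, which needs
  no carrier bookkeeping once it has been applied.
\<close>

lemma scalar_prod_mult_mat_vec:
  fixes M :: "real mat"
  assumes "M \<in> carrier_mat n m" "\<xi> \<in> carrier_vec m" "\<zeta> \<in> carrier_vec n"
  shows "scalar_prod (M *\<^sub>v \<xi>) \<zeta> = (\<Sum>i<n. \<Sum>k<m. M $$ (i, k) * \<xi> $ k * \<zeta> $ i)"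
  using assms
  by (auto simp: scalar_prod_def sum_distrib_right atLeast0LessThan intro!: sum.cong)

lemma scalar_prod_transpose_mat:
  fixes M :: "real mat"
  assumes "M \<in> carrier_mat n n" "\<xi> \<in> carrier_vec n" "\<zeta> \<in> carrier_vec n"
  shows "scalar_prod (transpose_mat M *\<^sub>v \<xi>) \<zeta> = scalar_prod \<xi> (M *\<^sub>v \<zeta>)"
proof -
  have "scalar_prod \<xi> (M *\<^sub>v \<zeta>) = scalar_prod (M *\<^sub>v \<zeta>) \<xi>"
    using assms by (intro comm_scalar_prod[of _ n]) auto
  also have "\<dots> = (\<Sum>i<n. \<Sum>k<n. M $$ (i, k) * \<zeta> $ k * \<xi> $ i)"
    using assms by (intro scalar_prod_mult_mat_vec) auto
  also have "\<dots> = (\<Sum>k<n. \<Sum>i<n. M $$ (i, k) * \<zeta> $ k * \<xi> $ i)"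
    by (rule sum.swap)
  also have "\<dots> = scalar_prod (transpose_mat M *\<^sub>v \<xi>) \<zeta>"
    using assms
    by (subst scalar_prod_mult_mat_vec[of _ n n]) (auto intro!: sum.cong)
  finally show ?thesis by simp
qed

lemma zero_matI_form:
  fixes M :: "real mat"
  assumes M: "M \<in> carrier_mat n n"
    and z: "\<And>\<xi> \<zeta>. \<xi> \<in> carrier_vec n \<Longrightarrow> \<zeta> \<in> carrier_vec n \<Longrightarrow> scalar_prod (M *\<^sub>v \<xi>) \<zeta> = 0"
  shows "M = 0\<^sub>m n n"
proof (rule eq_matI)
  fix i j assume ij: "i < dim_row (0\<^sub>m n n :: real mat)" "j < dim_col (0\<^sub>m n n :: real mat)"
  then have "scalar_prod (M *\<^sub>v unit_vec n j) (unit_vec n i) = M $$ (i, j)"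
    using M by simp
  then show "M $$ (i, j) = 0\<^sub>m n n $$ (i, j)"
    using z[of "unit_vec n j" "unit_vec n i"] ij by simp
qed (use M in auto)

text \<open>
  The summation set is allowed to be larger than the support so that several polynomials, or a
  polynomial and its image under a map of words, can be evaluated over one common set.
\<close>

lemma nc_eval_form:
  assumes \<rho>: "\<rho> \<in> sym_tuples n" and S: "finite S" "Poly_Mapping.keys p \<subseteq> S"
    and \<xi>: "\<xi> \<in> carrier_vec n" and \<zeta>: "\<zeta> \<in> carrier_vec n"
  shows "scalar_prod (nc_eval n \<rho> p *\<^sub>v \<xi>) \<zeta> =
    (\<Sum>w\<in>S. Poly_Mapping.lookup p w * scalar_prod (word_eval n \<rho> w *\<^sub>v \<xi>) \<zeta>)"
proof -
  have "scalar_prod (nc_eval n \<rho> p *\<^sub>v \<xi>) \<zeta> =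
      (\<Sum>i<n. \<Sum>k<n. \<Sum>w\<in>S. Poly_Mapping.lookup p w * (word_eval n \<rho> w $$ (i, k) * \<xi> $ k * \<zeta> $ i))"
    using \<xi> \<zeta>
    by (simp add: scalar_prod_mult_mat_vec[of _ n n] nc_eval_index[OF S] sum_distrib_right mult.assoc)
  also have "\<dots> = (\<Sum>i<n. \<Sum>w\<in>S. \<Sum>k<n.
      Poly_Mapping.lookup p w * (word_eval n \<rho> w $$ (i, k) * \<xi> $ k * \<zeta> $ i))"
    by (intro sum.cong refl) (rule sum.swap)
  also have "\<dots> = (\<Sum>w\<in>S. \<Sum>i<n. \<Sum>k<n.
      Poly_Mapping.lookup p w * (word_eval n \<rho> w $$ (i, k) * \<xi> $ k * \<zeta> $ i))"
    by (rule sum.swap)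
  also have "\<dots> = (\<Sum>w\<in>S. Poly_Mapping.lookup p w * scalar_prod (word_eval n \<rho> w *\<^sub>v \<xi>) \<zeta>)"
    using \<xi> \<zeta> word_eval_carrier[OF \<rho>]
    by (simp add: scalar_prod_mult_mat_vec[of _ n n] sum_distrib_left)
  finally show ?thesis .
qed

lemma nc_eval_nct:
  assumes \<rho>: "\<rho> \<in> sym_tuples n"
  shows "nc_eval n \<rho> (nct p) = transpose_mat (nc_eval n \<rho> p)"
proof (rule eq_matI)
  fix i k assume "i < dim_row (transpose_mat (nc_eval n \<rho> p))" "k < dim_col (transpose_mat (nc_eval n \<rho> p))"
  then have ik: "i < n" "k < n" by simp_all
  let ?K = "Poly_Mapping.keys p"
  have K: "Poly_Mapping.keys (nct p) \<subseteq> rev ` ?K"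
    by (auto simp: in_keys_iff lookup_nct intro!: image_eqI[of _ rev "rev _"])
  have "nc_eval n \<rho> (nct p) $$ (i, k) =
      (\<Sum>w\<in>rev ` ?K. Poly_Mapping.lookup p (rev w) * word_eval n \<rho> w $$ (i, k))"
    by (subst nc_eval_index[OF _ K ik]) (simp_all add: lookup_nct)
  also have "\<dots> = (\<Sum>w\<in>?K. Poly_Mapping.lookup p w * word_eval n \<rho> w $$ (k, i))"
    using ik carrier_matD[OF word_eval_carrier[OF \<rho>]]
    by (subst sum.reindex) (auto simp: word_eval_rev[OF \<rho>])
  also have "\<dots> = transpose_mat (nc_eval n \<rho> p) $$ (i, k)"
    using ik by (simp add: nc_eval_index[of ?K])
  finally show "nc_eval n \<rho> (nct p) $$ (i, k) = transpose_mat (nc_eval n \<rho> p) $$ (i, k)" .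
qed simp_all

lemma nc_eval_form_sum:
  assumes \<rho>: "\<rho> \<in> sym_tuples n" and \<xi>: "\<xi> \<in> carrier_vec n" and \<zeta>: "\<zeta> \<in> carrier_vec n"
    and "finite I"
  shows "scalar_prod (nc_eval n \<rho> (\<Sum>i\<in>I. q i) *\<^sub>v \<xi>) \<zeta> =
    (\<Sum>i\<in>I. scalar_prod (nc_eval n \<rho> (q i) *\<^sub>v \<xi>) \<zeta>)"
proof -
  let ?S = "\<Union>i\<in>I. Poly_Mapping.keys (q i)"
  let ?f = "\<lambda>w. scalar_prod (word_eval n \<rho> w *\<^sub>v \<xi>) \<zeta>"
  have S: "finite ?S" "Poly_Mapping.keys (q i) \<subseteq> ?S" if "i \<in> I" for i
    using \<open>finite I\<close> that by auto
  have fin: "finite ?S"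
    using \<open>finite I\<close> by simp
  have sub: "Poly_Mapping.keys (\<Sum>i\<in>I. q i) \<subseteq> ?S"
    by (rule Poly_Mapping.keys_sum)
  have "scalar_prod (nc_eval n \<rho> (\<Sum>i\<in>I. q i) *\<^sub>v \<xi>) \<zeta> =
      (\<Sum>w\<in>?S. \<Sum>i\<in>I. Poly_Mapping.lookup (q i) w * ?f w)"
    by (simp add: nc_eval_form[OF \<rho> fin sub \<xi> \<zeta>] lookup_sum sum_distrib_right)
  also have "\<dots> = (\<Sum>i\<in>I. \<Sum>w\<in>?S. Poly_Mapping.lookup (q i) w * ?f w)"
    by (rule sum.swap)
  also have "\<dots> = (\<Sum>i\<in>I. scalar_prod (nc_eval n \<rho> (q i) *\<^sub>v \<xi>) \<zeta>)"
    by (intro sum.cong refl) (simp add: nc_eval_form[OF \<rho> S \<xi> \<zeta>])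
  finally show ?thesis .
qed

lemma nc_eval_form_mono_mult_mono:
  assumes \<rho>: "\<rho> \<in> sym_tuples n" and \<xi>: "\<xi> \<in> carrier_vec n" and \<zeta>: "\<zeta> \<in> carrier_vec n"
  shows "scalar_prod (nc_eval n \<rho> (nc_mono (rev u) * q * nc_mono w) *\<^sub>v \<xi>) \<zeta> =
    scalar_prod (nc_eval n \<rho> q *\<^sub>v (word_eval n \<rho> w *\<^sub>v \<xi>)) (word_eval n \<rho> u *\<^sub>v \<zeta>)"
proof -
  let ?g = "\<lambda>s. rev u @ s @ w"
  note W = word_eval_carrier[OF \<rho>]
  have W\<xi>: "word_eval n \<rho> w *\<^sub>v \<xi> \<in> carrier_vec n"
    by (rule mult_mat_vec_carrier[OF W \<xi>])
  have inj: "inj_on ?g (Poly_Mapping.keys q)"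
    by (simp add: inj_on_def)
  have sub: "Poly_Mapping.keys (nc_mono (rev u) * q * nc_mono w) \<subseteq> ?g ` Poly_Mapping.keys q"
    using lookup_nc_mono_mult_nc_mono_nz[of "rev u" q w] by (fastforce simp: in_keys_iff)
  have eq: "scalar_prod (word_eval n \<rho> (?g s) *\<^sub>v \<xi>) \<zeta> =
      scalar_prod (word_eval n \<rho> s *\<^sub>v (word_eval n \<rho> w *\<^sub>v \<xi>)) (word_eval n \<rho> u *\<^sub>v \<zeta>)" for s
  proof -
    have "word_eval n \<rho> (?g s) *\<^sub>v \<xi> =
        transpose_mat (word_eval n \<rho> u) *\<^sub>v (word_eval n \<rho> s *\<^sub>v (word_eval n \<rho> w *\<^sub>v \<xi>))"
      by (simp add: word_eval_append_mult_vec[OF \<rho>] word_eval_rev[OF \<rho>, symmetric] W\<xi> \<xi>)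
    moreover have "word_eval n \<rho> s *\<^sub>v (word_eval n \<rho> w *\<^sub>v \<xi>) \<in> carrier_vec n"
      using W \<xi> by (meson mult_mat_vec_carrier)
    ultimately show ?thesis
      using W \<zeta> by (simp add: scalar_prod_transpose_mat[of _ n])
  qed
  have "scalar_prod (nc_eval n \<rho> (nc_mono (rev u) * q * nc_mono w) *\<^sub>v \<xi>) \<zeta> =
      (\<Sum>s\<in>Poly_Mapping.keys q. Poly_Mapping.lookup q s * scalar_prod (word_eval n \<rho> (?g s) *\<^sub>v \<xi>) \<zeta>)"
    by (simp add: nc_eval_form[OF \<rho> _ sub \<xi> \<zeta>] sum.reindex[OF inj] lookup_nc_mono_mult_nc_mono)
  also have "\<dots> = scalar_prod (nc_eval n \<rho> q *\<^sub>v (word_eval n \<rho> w *\<^sub>v \<xi>)) (word_eval n \<rho> u *\<^sub>v \<zeta>)"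
    unfolding eq
    by (rule nc_eval_form[symmetric, OF \<rho>]) (auto intro: W\<xi> mult_mat_vec_carrier[OF W \<zeta>])
  finally show ?thesis .
qed

text \<open>
  This is how the Hessian form is read off from a border vector and a middle matrix: the outer words
  are moved onto the vector, since evaluation at symmetric matrices turns the reversed word on the
  left into a transpose.
\<close>

lemma nc_eval_form_sandwich:
  assumes \<rho>: "\<rho> \<in> sym_tuples n" and \<xi>: "\<xi> \<in> carrier_vec n" and "finite I"
  shows "scalar_prod (nc_eval n \<rho> (sandwich I (\<lambda>u. nc_mono (f u)) M) *\<^sub>v \<xi>) \<xi> =
    (\<Sum>u\<in>I. \<Sum>w\<in>I. scalar_prod
      (nc_eval n \<rho> (M u w) *\<^sub>v (word_eval n \<rho> (f w) *\<^sub>v \<xi>)) (word_eval n \<rho> (f u) *\<^sub>v \<xi>))"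
  by (simp add: sandwich_def nct_nc_mono nc_eval_form_sum[OF \<rho> \<xi> \<xi> \<open>finite I\<close>]
      nc_eval_form_mono_mult_mono[OF \<rho> \<xi> \<xi>])

section \<open>Interpolation by symmetric matrices on a doubled space\<close>

text \<open>
  Gaussian elimination: a coordinate \<open>c\<close> at which \<open>f i\<close> does not vanish is used to clear that
  coordinate in all other vectors. A functional with the right values on the cleared vectors may then
  be changed at \<open>c\<close> alone, which adjusts its value on \<open>f i\<close> and leaves the others untouched.
\<close>

lemma ex_interpolating_functional:
  fixes f :: "'i \<Rightarrow> nat \<Rightarrow> real"
  assumes "finite I"
    and "\<And>c. (\<And>r. r < n \<Longrightarrow> (\<Sum>i\<in>I. c i * f i r) = 0) \<Longrightarrow> \<forall>i\<in>I. c i = 0"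
  shows "\<exists>\<phi>. \<forall>i\<in>I. (\<Sum>r<n. \<phi> r * f i r) = y i"
  using assms
proof (induction I arbitrary: f y rule: finite_induct)
  case (insert i I)
  note indep = insert.prems
  obtain c where c: "c < n" "f i c \<noteq> 0"
  proof -
    have "\<not> (\<forall>r<n. f i r = 0)"
    proof
      assume z: "\<forall>r<n. f i r = 0"
      have "\<forall>k\<in>insert i I. (if k = i then 1 else 0 :: real) = 0"
      proof (rule indep)
        fix r assume "r < n"
        with z show "(\<Sum>k\<in>insert i I. (if k = i then 1 else 0) * f k r) = 0"
          by (intro sum.neutral) auto
      qed
      then show False by simp
    qed
    then show thesis using that by blast
  qed
  define \<beta> where "\<beta> k = f k c / f i c" for k
  define f' where "f' k r = f k r - \<beta> k * f i r" for k r
  have "\<exists>\<phi>. \<forall>k\<in>I. (\<Sum>r<n. \<phi> r * f' k r) = y k - \<beta> k * y i"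
  proof (rule insert.IH)
    fix e :: "'i \<Rightarrow> real"
    assume e: "\<And>r. r < n \<Longrightarrow> (\<Sum>k\<in>I. e k * f' k r) = 0"
    define e' where "e' = e(i := - (\<Sum>k\<in>I. e k * \<beta> k))"
    have e': "e' k = e k" if "k \<in> I" for k
      using that insert.hyps by (auto simp: e'_def)
    have "\<forall>k\<in>insert i I. e' k = 0"
    proof (rule indep)
      fix r assume "r < n"
      have "(\<Sum>k\<in>insert i I. e' k * f k r) = e' i * f i r + (\<Sum>k\<in>I. e k * f k r)"
        using insert.hyps by (simp add: e')
      also have "\<dots> = (\<Sum>k\<in>I. e k * f' k r)"
        by (simp add: e'_def f'_def algebra_simps sum_subtractf sum_distrib_left)
      finally show "(\<Sum>k\<in>insert i I. e' k * f k r) = 0"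
        using e[OF \<open>r < n\<close>] by simp
    qed
    then show "\<forall>k\<in>I. e k = 0"
      using e' by auto
  qed
  then obtain \<phi> where \<phi>: "\<forall>k\<in>I. (\<Sum>r<n. \<phi> r * f' k r) = y k - \<beta> k * y i"
    by blast
  \<comment> \<open>The correction at coordinate \<open>c\<close>, where all \<open>f' k\<close> vanish, repairs the value on \<open>f i\<close>.\<close>
  define \<alpha> where "\<alpha> = (y i - (\<Sum>r<n. \<phi> r * f i r)) / f i c"
  define \<psi> where "\<psi> r = \<phi> r + (if r = c then \<alpha> else 0)" for r
  have \<psi>: "(\<Sum>r<n. \<psi> r * g r) = (\<Sum>r<n. \<phi> r * g r) + \<alpha> * g c" for g
  proof -
    have "(\<Sum>r<n. \<psi> r * g r) = (\<Sum>r<n. \<phi> r * g r) + (\<Sum>r<n. if r = c then \<alpha> * g r else 0)"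
      unfolding sum.distrib[symmetric] by (intro sum.cong) (auto simp: \<psi>_def distrib_right)
    then show ?thesis
      using c(1) by simp
  qed
  have yi: "(\<Sum>r<n. \<psi> r * f i r) = y i"
    using c(2) by (simp add: \<psi> \<alpha>_def)
  have "(\<Sum>r<n. \<psi> r * f k r) = y k" if "k \<in> I" for k
  proof -
    have "(\<Sum>r<n. \<psi> r * f k r) = (\<Sum>r<n. \<psi> r * f' k r) + \<beta> k * (\<Sum>r<n. \<psi> r * f i r)"
      by (simp add: f'_def algebra_simps sum_subtractf sum_distrib_left)
    also have "(\<Sum>r<n. \<psi> r * f' k r) = y k - \<beta> k * y i"
      using \<phi> that c(2) unfolding \<psi> by (simp add: f'_def \<beta>_def)
    finally show ?thesis
      by (simp add: yi)
  qed
  with yi show ?case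
    by (intro exI[of _ \<psi>]) simp
qed simp

lemma ex_interpolating_mat:
  assumes "finite I" and indep: "lin_indep_family n I f"
    and f: "\<And>i. i \<in> I \<Longrightarrow> f i \<in> carrier_vec n"
    and \<eta>: "\<And>i. i \<in> I \<Longrightarrow> \<eta> i \<in> carrier_vec n"
  shows "\<exists>T\<in>carrier_mat n n. \<forall>i\<in>I. T *\<^sub>v f i = \<eta> i"
proof -
  have "\<exists>\<phi>. \<forall>i\<in>I. (\<Sum>k<n. \<phi> k * f i $ k) = \<eta> i $ r" for r
  proof (rule ex_interpolating_functional[OF \<open>finite I\<close>])
    fix c :: "_ \<Rightarrow> real"
    assume c: "\<And>k. k < n \<Longrightarrow> (\<Sum>i\<in>I. c i * f i $ k) = 0"
    have fc: "(\<lambda>i. c i \<cdot>\<^sub>v f i) \<in> I \<rightarrow> carrier_vec n"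
      using f by auto
    have "finsum_vec TYPE(real) n (\<lambda>i. c i \<cdot>\<^sub>v f i) I = 0\<^sub>v n"
    proof (rule eq_vecI)
      fix k assume "k < dim_vec (0\<^sub>v n :: real vec)"
      then have k: "k < n" by simp
      have "(\<Sum>i\<in>I. (c i \<cdot>\<^sub>v f i) $ k) = (\<Sum>i\<in>I. c i * f i $ k)"
        using carrier_vecD[OF f] k by (intro sum.cong) simp_all
      then show "finsum_vec TYPE(real) n (\<lambda>i. c i \<cdot>\<^sub>v f i) I $ k = 0\<^sub>v n $ k"
        using k by (simp add: index_finsum_vec[OF \<open>finite I\<close> k fc] c)
    qed (use finsum_vec_closed[OF fc] in auto)
    then show "\<forall>i\<in>I. c i = 0"
      using indep by (simp add: lin_indep_family_def)
  qed
  then obtain \<Phi> where \<Phi>: "\<And>r i. i \<in> I \<Longrightarrow> (\<Sum>k<n. \<Phi> r k * f i $ k) = \<eta> i $ r"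
    by metis
  have "mat n n (\<lambda>(r, k). \<Phi> r k) *\<^sub>v f i = \<eta> i" if "i \<in> I" for i
    using f[OF that] \<eta>[OF that] \<Phi>[OF that]
    by (intro eq_vecI) (auto simp: scalar_prod_def atLeast0LessThan)
  then show ?thesis
    by (intro bexI[of _ "mat n n (\<lambda>(r, k). \<Phi> r k)"]) auto
qed

text \<open>
  A single symmetric matrix cannot send given vectors to arbitrary targets. Two copies of the space
  remove the obstruction: with \<open>e = (1, -1)\<close> and \<open>\<one> = (1, 1)\<close> orthogonal in \<open>\<real>\<^sup>2\<close>, the symmetric
  matrix \<open>T \<otimes> e \<one>\<^sup>T + T\<^sup>T \<otimes> \<one> e\<^sup>T\<close> acts on \<open>f \<otimes> \<one>\<close> through its first summand only and gives
  \<open>2 T f \<otimes> e\<close>.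
\<close>

lemma ex_symmetric_dilation:
  fixes T :: "real mat"
  assumes T: "T \<in> carrier_mat n n"
  shows "\<exists>H\<in>carrier_mat (n * 2) (n * 2). transpose_mat H = H \<and>
    (\<forall>f\<in>carrier_vec n. H *\<^sub>v (f @\<^sub>v f) = (T *\<^sub>v f) @\<^sub>v - (T *\<^sub>v f))"
proof -
  \<comment> \<open>Scaled so that \<open>S f + S f = T f\<close>.\<close>
  define S where "S = (1/2) \<cdot>\<^sub>m T"
  define H where "H = four_block_mat (S + transpose_mat S) (S - transpose_mat S)
    (transpose_mat S - S) (- (S + transpose_mat S))"
  have S: "S \<in> carrier_mat n n" "transpose_mat S \<in> carrier_mat n n"
    using T by (simp_all add: S_def)
  have "H \<in> carrier_mat (n * 2) (n * 2)"
    using S by (auto simp: H_def)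
  moreover have "transpose_mat H = H"
    using S by (auto simp: H_def intro!: eq_matI)
  moreover have "H *\<^sub>v (f @\<^sub>v f) = (T *\<^sub>v f) @\<^sub>v - (T *\<^sub>v f)" if f: "f \<in> carrier_vec n" for f
  proof -
    have Sf: "S *\<^sub>v f \<in> carrier_vec n" "transpose_mat S *\<^sub>v f \<in> carrier_vec n"
      using S f by auto
    have "S *\<^sub>v f + S *\<^sub>v f = T *\<^sub>v f"
      using T f by (intro eq_vecI) (auto simp: S_def)
    moreover have "(- (S + transpose_mat S)) *\<^sub>v f = - (S *\<^sub>v f + transpose_mat S *\<^sub>v f)"
      using S f by (simp add: add_mult_distrib_mat_vec[of _ n n])
    moreover have "H *\<^sub>v (f @\<^sub>v f) =
      ((S + transpose_mat S) *\<^sub>v f + (S - transpose_mat S) *\<^sub>v f) @\<^sub>v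
      ((transpose_mat S - S) *\<^sub>v f + (- (S + transpose_mat S)) *\<^sub>v f)"
      unfolding H_def using S f by (intro four_block_mat_mult_vec[of _ n n _ n _ n]) auto
    moreover have "(S + transpose_mat S) *\<^sub>v f + (S - transpose_mat S) *\<^sub>v f = S *\<^sub>v f + S *\<^sub>v f"
      using S f Sf
      by (auto simp: add_mult_distrib_mat_vec[of _ n n] minus_mult_distrib_mat_vec[of _ n n]
          intro!: eq_vecI)
    moreover have "(transpose_mat S - S) *\<^sub>v f + - (S *\<^sub>v f + transpose_mat S *\<^sub>v f) =
        - (S *\<^sub>v f + S *\<^sub>v f)"
      using S f Sf
      by (auto simp: minus_mult_distrib_mat_vec[of _ n n] intro!: eq_vecI)
    ultimately show ?thesis by simp
  qed
  ultimately show ?thesis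
    by (intro bexI[of _ H]) auto
qed

lemma ampl_vec_2:
  assumes "v \<in> carrier_vec n"
  shows "ampl_vec 2 v = v @\<^sub>v v"
proof (rule eq_vecI)
  fix i assume "i < dim_vec (v @\<^sub>v v)"
  then have i: "i < n + n"
    using assms by simp
  show "ampl_vec 2 v $ i = (v @\<^sub>v v) $ i"
    using i assms by (cases "i < n") (auto simp: ampl_vec_def le_mod_geq)
qed (simp add: ampl_vec_def)

lemma ampl_2:
  assumes "A j \<in> carrier_mat n n"
  shows "ampl 2 A j = four_block_mat (A j) (0\<^sub>m n n) (0\<^sub>m n n) (A j)"
proof -
  have "ampl 2 A j = diag_block_mat [A j, A j]"
    by (simp add: ampl_def numeral_2_eq_2)
  then show ?thesis
    using assms unfolding diag_block_mat.simps(2)[of "A j" "[A j]"] diag_block_mat_singleton Let_def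
    by simp
qed

lemma ampl_2_in_sym_tuples:
  assumes "A \<in> sym_tuples n"
  shows "ampl 2 A \<in> sym_tuples (n * 2)"
proof -
  have "ampl 2 A j \<in> carrier_mat (n * 2) (n * 2) \<and> transpose_mat (ampl 2 A j) = ampl 2 A j" for j
  proof -
    note * = sym_tuplesD[OF assms, of j]
    have "transpose_mat (ampl 2 A j) = ampl 2 A j"
      using * by (simp add: ampl_2 transpose_four_block_mat[of _ n n _ n _ n])
    moreover have "ampl 2 A j \<in> carrier_mat (n * 2) (n * 2)"
      using * by (auto simp: ampl_2)
    ultimately show ?thesis by simp
  qed
  then show ?thesis
    by (simp add: sym_tuples_def)
qed

text \<open>
  The two copies are mixed by \<open>H\<close> only; the letters \<open>a\<close> and \<open>x\<close> act by block diagonal matrices with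
  equal blocks.
\<close>

lemma word_eval_ampl:
  assumes A: "A \<in> sym_tuples n" and X: "X \<in> sym_tuples n" and G: "G \<in> sym_tuples n"
    and H: "H \<in> sym_tuples (n * 2)"
    and m: "m \<in> lists (avars \<union> xvars)" and a: "a \<in> carrier_vec n" and b: "b \<in> carrier_vec n"
  shows "word_eval (n * 2) (assign (ampl 2 A) (ampl 2 X) H) m *\<^sub>v (a @\<^sub>v b) =
    (word_eval n (assign A X G) m *\<^sub>v a) @\<^sub>v (word_eval n (assign A X G) m *\<^sub>v b)"
  using m
proof (induction m)
  case Nil
  have "a @\<^sub>v b \<in> carrier_vec (n * 2)"
    using append_carrier_vec[OF a b] by (simp add: mult_2_right)
  then show ?case
    using a b by simp
next
  case (Cons x m)
  let ?\<rho> = "assign A X G" and ?\<sigma> = "assign (ampl 2 A) (ampl 2 X) H"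
  have \<rho>: "?\<rho> \<in> sym_tuples n"
    using A X G by (rule assign_in_sym_tuples)
  have \<sigma>: "?\<sigma> \<in> sym_tuples (n * 2)"
    using A X H by (intro assign_in_sym_tuples ampl_2_in_sym_tuples)
  have W: "word_eval n ?\<rho> m *\<^sub>v a \<in> carrier_vec n" "word_eval n ?\<rho> m *\<^sub>v b \<in> carrier_vec n"
    using word_eval_carrier[OF \<rho>, of m] a b by auto
  have x: "?\<sigma> x = four_block_mat (?\<rho> x) (0\<^sub>m n n) (0\<^sub>m n n) (?\<rho> x)"
    using Cons.hyps sym_tuplesD(1)[OF A] sym_tuplesD(1)[OF X] by (auto simp: ampl_2)
  have split: "word_eval k \<tau> (x # m) *\<^sub>v \<xi> = \<tau> x *\<^sub>v (word_eval k \<tau> m *\<^sub>v \<xi>)"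
    if "\<tau> \<in> sym_tuples k" "\<xi> \<in> carrier_vec k" for k and \<tau> :: "_ \<Rightarrow> real mat" and \<xi>
    using assoc_mult_mat_vec[OF sym_tuplesD(1)[OF that(1)] word_eval_carrier[OF that(1)] that(2)]
    by simp
  have "a @\<^sub>v b \<in> carrier_vec (n * 2)"
    using append_carrier_vec[OF a b] by (simp add: mult_2_right)
  then have "word_eval (n * 2) ?\<sigma> (x # m) *\<^sub>v (a @\<^sub>v b) =
      ?\<sigma> x *\<^sub>v ((word_eval n ?\<rho> m *\<^sub>v a) @\<^sub>v (word_eval n ?\<rho> m *\<^sub>v b))"
    using Cons.IH by (simp only: split[OF \<sigma>])
  also have "\<dots> = (?\<rho> x *\<^sub>v (word_eval n ?\<rho> m *\<^sub>v a)) @\<^sub>v (?\<rho> x *\<^sub>v (word_eval n ?\<rho> m *\<^sub>v b))"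
    unfolding x by (rule mult_mat_vec_split) (use \<rho> W in \<open>auto intro: sym_tuplesD\<close>)
  finally show ?case
    by (simp only: split[OF \<rho> a] split[OF \<rho> b])
qed

lemma nc_eval_form_ampl:
  assumes A: "A \<in> sym_tuples n" and X: "X \<in> sym_tuples n" and G: "G \<in> sym_tuples n"
    and H: "H \<in> sym_tuples (n * 2)" and q: "q \<in> ncpolys (avars \<union> xvars)"
    and ab: "a \<in> carrier_vec n" "b \<in> carrier_vec n" and cd: "c \<in> carrier_vec n" "d \<in> carrier_vec n"
  shows "scalar_prod (nc_eval (n * 2) (assign (ampl 2 A) (ampl 2 X) H) q *\<^sub>v (a @\<^sub>v b)) (c @\<^sub>v d) =
    scalar_prod (nc_eval n (assign A X G) q *\<^sub>v a) c + scalar_prod (nc_eval n (assign A X G) q *\<^sub>v b) d"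
proof -
  let ?\<rho> = "assign A X G" and ?\<sigma> = "assign (ampl 2 A) (ampl 2 X) H"
  let ?K = "Poly_Mapping.keys q"
  have \<rho>: "?\<rho> \<in> sym_tuples n"
    using A X G by (rule assign_in_sym_tuples)
  have \<sigma>: "?\<sigma> \<in> sym_tuples (n * 2)"
    using A X H by (intro assign_in_sym_tuples ampl_2_in_sym_tuples)
  have car: "a @\<^sub>v b \<in> carrier_vec (n * 2)" "c @\<^sub>v d \<in> carrier_vec (n * 2)"
    using append_carrier_vec[OF ab] append_carrier_vec[OF cd] by (simp_all add: mult_2_right)
  have K: "finite ?K" "?K \<subseteq> ?K" by simp_all
  have "scalar_prod (nc_eval (n * 2) ?\<sigma> q *\<^sub>v (a @\<^sub>v b)) (c @\<^sub>v d) =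
      (\<Sum>w\<in>?K. Poly_Mapping.lookup q w * (scalar_prod (word_eval n ?\<rho> w *\<^sub>v a) c
        + scalar_prod (word_eval n ?\<rho> w *\<^sub>v b) d))"
    unfolding nc_eval_form[OF \<sigma> K car]
  proof (intro sum.cong refl)
    fix w assume "w \<in> ?K"
    then have "w \<in> lists (avars \<union> xvars)"
      using q by (auto simp: ncpolys_def)
    then have "word_eval (n * 2) ?\<sigma> w *\<^sub>v (a @\<^sub>v b) = (word_eval n ?\<rho> w *\<^sub>v a) @\<^sub>v (word_eval n ?\<rho> w *\<^sub>v b)"
      using A X G H ab by (intro word_eval_ampl)
    moreover have "word_eval n ?\<rho> w *\<^sub>v a \<in> carrier_vec n" "word_eval n ?\<rho> w *\<^sub>v b \<in> carrier_vec n"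
      using mult_mat_vec_carrier[OF word_eval_carrier[OF \<rho>]] ab by blast+
    ultimately show "Poly_Mapping.lookup q w * scalar_prod (word_eval (n * 2) ?\<sigma> w *\<^sub>v (a @\<^sub>v b)) (c @\<^sub>v d) =
      Poly_Mapping.lookup q w * (scalar_prod (word_eval n ?\<rho> w *\<^sub>v a) c
        + scalar_prod (word_eval n ?\<rho> w *\<^sub>v b) d)"
      using cd by (simp add: scalar_prod_append[of _ n _ n])
  qed
  also have "\<dots> = scalar_prod (nc_eval n ?\<rho> q *\<^sub>v a) c + scalar_prod (nc_eval n ?\<rho> q *\<^sub>v b) d"
    using ab cd by (simp add: nc_eval_form[OF \<rho> K] distrib_left sum.distrib)
  finally show ?thesis .
qed

section \<open>Positivity of the middle matrix\<close>

lemma finite_border_monos: "finite (border_monos da dx :: 'g::finite var list set)"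
proof (rule finite_subset)
  show "(border_monos da dx :: 'g var list set) \<subseteq> (#) (Hvar undefined) -` border da dx"
    by (auto simp: border_def)
  show "finite ((#) (Hvar undefined) -` (border da dx :: 'g var list set))"
    by (intro finite_vimageI finite_border) (simp add: inj_on_def)
qed

text \<open>
  For prescribed blocks \<open>\<eta> u\<close>, interpolation and dilation provide \<open>H\<close> such that every border word
  \<open>u\<close> sends \<open>(v, v)\<close> to \<open>(\<eta> u, - \<eta> u)\<close>. The Hessian form at this \<open>H\<close> is therefore twice the
  quadratic form of the middle matrix at \<open>\<eta>\<close>, so positivity along one vector gives positivity of the
  whole block matrix.
\<close>

lemma block_psd_if_doubled_form_nonneg:
  fixes Z :: "'g::finite var list \<Rightarrow> 'g var list \<Rightarrow> 'g var ncpoly"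
  assumes A: "A \<in> sym_tuples n" and chi: "chi \<in> sym_tuples n" and v: "v \<in> carrier_vec n"
    and Z: "\<And>u w. u \<in> border da dx \<Longrightarrow> w \<in> border da dx \<Longrightarrow> Z u w \<in> ncpolys (avars \<union> xvars)"
    and sym: "\<And>u w. u \<in> border da dx \<Longrightarrow> w \<in> border da dx \<Longrightarrow> nct (Z u w) = Z w u"
    and indep: "lin_indep_family n (border_monos da dx)
      (\<lambda>m. word_eval n (assign A chi (zero_tuple n)) m *\<^sub>v v)"
    and nonneg: "\<And>H. H \<in> sym_tuples (n * 2) \<Longrightarrow> 0 \<le> scalar_prod
      (nc_eval (n * 2) (assign (ampl 2 A) (ampl 2 chi) H) (sandwich (border da dx) nc_mono Z)
        *\<^sub>v ampl_vec 2 v) (ampl_vec 2 v)"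
  shows "block_psd n (border da dx) (\<lambda>u w. eval_ax n (Z u w) A chi)"
  unfolding block_psd_def
proof (intro conjI ballI allI impI)
  let ?B = "border da dx" and ?\<rho> = "assign A chi (zero_tuple n)"
  have \<rho>: "?\<rho> \<in> sym_tuples n"
    using A chi zero_tuple_in_sym_tuples by (rule assign_in_sym_tuples)
  fix u w :: "'g var list" assume "u \<in> ?B" "w \<in> ?B"
  then show "eval_ax n (Z u w) A chi \<in> carrier_mat n n"
    "transpose_mat (eval_ax n (Z u w) A chi) = eval_ax n (Z w u) A chi"
    by (simp_all add: sym nc_eval_nct[OF \<rho>, symmetric])
next
  let ?B = "border da dx" and ?\<rho> = "assign A chi (zero_tuple n)"
  let ?f = "\<lambda>m. word_eval n ?\<rho> m *\<^sub>v v"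
  have \<rho>: "?\<rho> \<in> sym_tuples n"
    using A chi zero_tuple_in_sym_tuples by (rule assign_in_sym_tuples)
  have f: "?f m \<in> carrier_vec n" for m
    by (rule mult_mat_vec_carrier[OF word_eval_carrier[OF \<rho>] v])
  fix \<eta> :: "'g var list \<Rightarrow> real vec" assume \<eta>: "\<forall>u\<in>?B. \<eta> u \<in> carrier_vec n"
  have "\<exists>H\<in>carrier_mat (n * 2) (n * 2). transpose_mat H = H \<and>
      (\<forall>m\<in>border_monos da dx. H *\<^sub>v (?f m @\<^sub>v ?f m) = \<eta> (Hvar j # m) @\<^sub>v - \<eta> (Hvar j # m))" for j
  proof -
    have "\<eta> (Hvar j # m) \<in> carrier_vec n" if "m \<in> border_monos da dx" for m
      using \<eta> that by (auto simp: border_def)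
    then obtain T where T: "T \<in> carrier_mat n n" "\<forall>m\<in>border_monos da dx. T *\<^sub>v ?f m = \<eta> (Hvar j # m)"
      using ex_interpolating_mat[OF finite_border_monos indep f, of "\<lambda>m. \<eta> (Hvar j # m)"] by blast
    obtain H where "H \<in> carrier_mat (n * 2) (n * 2)" "transpose_mat H = H"
      "\<forall>f\<in>carrier_vec n. H *\<^sub>v (f @\<^sub>v f) = (T *\<^sub>v f) @\<^sub>v - (T *\<^sub>v f)"
      using ex_symmetric_dilation[OF T(1)] by blast
    with T(2) f show ?thesis
      by (intro bexI[of _ H]) auto
  qed
  then obtain H where H: "\<And>j. H j \<in> carrier_mat (n * 2) (n * 2)" "\<And>j. transpose_mat (H j) = H j"
    and H\<eta>: "\<And>j m. m \<in> border_monos da dx \<Longrightarrow>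
      H j *\<^sub>v (?f m @\<^sub>v ?f m) = \<eta> (Hvar j # m) @\<^sub>v - \<eta> (Hvar j # m)"
    by metis
  have Hs: "H \<in> sym_tuples (n * 2)"
    using H by (simp add: sym_tuples_def)
  let ?\<sigma> = "assign (ampl 2 A) (ampl 2 chi) H"
  have \<sigma>: "?\<sigma> \<in> sym_tuples (n * 2)"
    using A chi Hs by (intro assign_in_sym_tuples ampl_2_in_sym_tuples)
  have vv: "v @\<^sub>v v \<in> carrier_vec (n * 2)"
    using append_carrier_vec[OF v v] by (simp add: mult_2_right)
  have eval: "word_eval (n * 2) ?\<sigma> u *\<^sub>v (v @\<^sub>v v) = \<eta> u @\<^sub>v - \<eta> u" if u_in: "u \<in> ?B" for u
  proof -
    obtain j m where u: "u = Hvar j # m" and m: "m \<in> border_monos da dx"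
      using u_in by (auto simp: border_def)
    then have "m \<in> lists (avars \<union> xvars)"
      by (simp add: border_monos_def)
    then have "word_eval (n * 2) ?\<sigma> m *\<^sub>v (v @\<^sub>v v) = ?f m @\<^sub>v ?f m"
      by (intro word_eval_ampl A chi zero_tuple_in_sym_tuples Hs v)
    moreover have "word_eval (n * 2) ?\<sigma> u *\<^sub>v (v @\<^sub>v v) =
        H j *\<^sub>v (word_eval (n * 2) ?\<sigma> m *\<^sub>v (v @\<^sub>v v))"
      unfolding u by (simp add: assoc_mult_mat_vec[OF H(1) word_eval_carrier[OF \<sigma>] vv])
    ultimately show ?thesis
      using H\<eta>[OF m] u by simp
  qed
  have "0 \<le> (\<Sum>u\<in>?B. \<Sum>w\<in>?B. scalar_prod (nc_eval (n * 2) ?\<sigma> (Z u w)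
      *\<^sub>v (word_eval (n * 2) ?\<sigma> w *\<^sub>v (v @\<^sub>v v))) (word_eval (n * 2) ?\<sigma> u *\<^sub>v (v @\<^sub>v v)))"
    using nonneg[OF Hs] nc_eval_form_sandwich[OF \<sigma> vv finite_border, where f = "\<lambda>u. u"]
    by (simp add: ampl_vec_2[OF v])
  also have "\<dots> = (\<Sum>u\<in>?B. \<Sum>w\<in>?B. 2 * scalar_prod (nc_eval n ?\<rho> (Z u w) *\<^sub>v \<eta> w) (\<eta> u))"
  proof (intro sum.cong refl)
    fix u w :: "'g var list" assume uw: "u \<in> ?B" "w \<in> ?B"
    then have car: "\<eta> u \<in> carrier_vec n" "\<eta> w \<in> carrier_vec n"
      using \<eta> by auto
    have "scalar_prod (nc_eval (n * 2) ?\<sigma> (Z u w) *\<^sub>v (\<eta> w @\<^sub>v - \<eta> w)) (\<eta> u @\<^sub>v - \<eta> u) =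
        scalar_prod (nc_eval n ?\<rho> (Z u w) *\<^sub>v \<eta> w) (\<eta> u) +
        scalar_prod (nc_eval n ?\<rho> (Z u w) *\<^sub>v (- \<eta> w)) (- \<eta> u)"
      using car uw by (intro nc_eval_form_ampl A chi zero_tuple_in_sym_tuples Hs Z) auto
    also have "\<dots> = 2 * scalar_prod (nc_eval n ?\<rho> (Z u w) *\<^sub>v \<eta> w) (\<eta> u)"
      using car by (simp add: scalar_prod_mult_mat_vec[of _ n n] sum_negf)
    finally show "scalar_prod (nc_eval (n * 2) ?\<sigma> (Z u w) *\<^sub>v (word_eval (n * 2) ?\<sigma> w *\<^sub>v (v @\<^sub>v v)))
        (word_eval (n * 2) ?\<sigma> u *\<^sub>v (v @\<^sub>v v)) =
        2 * scalar_prod (nc_eval n ?\<rho> (Z u w) *\<^sub>v \<eta> w) (\<eta> u)"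
      using uw by (simp add: eval)
  qed
  also have "\<dots> = 2 * (\<Sum>u\<in>?B. \<Sum>w\<in>?B. scalar_prod (nc_eval n ?\<rho> (Z u w) *\<^sub>v \<eta> w) (\<eta> u))"
    by (simp add: sum_distrib_left)
  finally show "0 \<le> (\<Sum>u\<in>?B. \<Sum>w\<in>?B. scalar_prod (eval_ax n (Z u w) A chi *\<^sub>v \<eta> w) (\<eta> u))"
    by simp
qed

lemma scalar_prod_mult_smult:
  fixes M :: "real mat"
  assumes "M \<in> carrier_mat n n" "\<xi> \<in> carrier_vec n" "\<zeta> \<in> carrier_vec n"
  shows "scalar_prod (M *\<^sub>v (s \<cdot>\<^sub>v \<xi>)) (t \<cdot>\<^sub>v \<zeta>) = s * t * scalar_prod (M *\<^sub>v \<xi>) \<zeta>"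
  using assms by (simp add: scalar_prod_mult_mat_vec[of _ n n] sum_distrib_left ac_simps)

lemma affine_nonneg_slope_zero:
  fixes c e :: real
  assumes "\<And>t. 0 \<le> t * c + e"
  shows "c = 0"
proof (rule ccontr)
  assume "c \<noteq> 0"
  then show False
    using assms[of "- (e + 1) / c"] by simp
qed

text \<open>
  On the vectors supported at \<open>u\<close> and \<open>w\<close> with block \<open>t \<zeta>\<close> at \<open>u\<close>, the form is affine in \<open>t\<close>
  because the quadratic term belongs to the vanishing diagonal block. An affine function that is
  nonnegative on the whole line is constant, and its slope is the off-diagonal entry.
\<close>

lemma block_psd_zero_diagonal:
  fixes M :: "'i \<Rightarrow> 'i \<Rightarrow> real mat"
  assumes psd: "block_psd n I M" and fin: "finite I" and u: "u \<in> I" and w: "w \<in> I"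
    and diag: "M u u = 0\<^sub>m n n"
  shows "M u w = 0\<^sub>m n n"
proof (cases "u = w")
  case False
  have car: "M i j \<in> carrier_mat n n" and tr: "transpose_mat (M i j) = M j i"
    if "i \<in> I" "j \<in> I" for i j
    using psd that by (auto simp: block_psd_def)
  show ?thesis
  proof (rule zero_matI_form)
    fix \<xi> \<zeta> :: "real vec" assume \<xi>: "\<xi> \<in> carrier_vec n" and \<zeta>: "\<zeta> \<in> carrier_vec n"
    have off: "scalar_prod (M w u *\<^sub>v \<zeta>) \<xi> = scalar_prod (M u w *\<^sub>v \<xi>) \<zeta>"
      using scalar_prod_transpose_mat[OF car[OF u w] \<zeta> \<xi>] tr[OF u w]
        comm_scalar_prod[OF \<zeta> mult_mat_vec_carrier[OF car[OF u w] \<xi>]] by simp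
    have "0 \<le> t * (2 * scalar_prod (M u w *\<^sub>v \<xi>) \<zeta>) + scalar_prod (M w w *\<^sub>v \<xi>) \<xi>" for t
    proof -
      \<comment> \<open>The test vector with block \<open>t \<zeta>\<close> at \<open>u\<close> and \<open>\<xi>\<close> at \<open>w\<close>.\<close>
      define \<eta> where "\<eta> i = (if i = u then t \<cdot>\<^sub>v \<zeta> else if i = w then \<xi> else 0\<^sub>v n)" for i
      have z: "scalar_prod (M i j *\<^sub>v 0\<^sub>v n) \<omega> = 0" "scalar_prod (M i j *\<^sub>v \<omega>) (0\<^sub>v n) = 0"
        if "i \<in> I" "j \<in> I" "\<omega> \<in> carrier_vec n" for i j \<omega>
        using car[OF that(1,2)] that(3) by (simp_all add: scalar_prod_mult_mat_vec[of _ n n])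
      have \<eta>: "\<eta> i \<in> carrier_vec n" for i
        using \<xi> \<zeta> by (simp add: \<eta>_def)
      have \<eta>0: "\<eta> i = 0\<^sub>v n" if "i \<noteq> u" "i \<noteq> w" for i
        using that by (simp add: \<eta>_def)
      have "(\<Sum>i\<in>I. \<Sum>j\<in>I. scalar_prod (M i j *\<^sub>v \<eta> j) (\<eta> i)) =
          (\<Sum>i\<in>{u, w}. \<Sum>j\<in>I. scalar_prod (M i j *\<^sub>v \<eta> j) (\<eta> i))"
        using u w fin \<eta> by (intro sum.mono_neutral_right) (auto simp: \<eta>0 z intro!: sum.neutral)
      also have "\<dots> = (\<Sum>i\<in>{u, w}. \<Sum>j\<in>{u, w}. scalar_prod (M i j *\<^sub>v \<eta> j) (\<eta> i))"
        using u w fin \<eta> by (intro sum.cong refl sum.mono_neutral_right) (auto simp: \<eta>0 z)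
      also have "\<dots> = t * (2 * scalar_prod (M u w *\<^sub>v \<xi>) \<zeta>) + scalar_prod (M w w *\<^sub>v \<xi>) \<xi>"
      proof -
        have "scalar_prod (M u u *\<^sub>v (t \<cdot>\<^sub>v \<zeta>)) (t \<cdot>\<^sub>v \<zeta>) = 0"
          using \<zeta> by (simp add: diag scalar_prod_mult_mat_vec[of _ n n])
        moreover have "scalar_prod (M u w *\<^sub>v \<xi>) (t \<cdot>\<^sub>v \<zeta>) = t * scalar_prod (M u w *\<^sub>v \<xi>) \<zeta>"
          using scalar_prod_mult_smult[OF car[OF u w] \<xi> \<zeta>, of 1 t] by simp
        moreover have "scalar_prod (M w u *\<^sub>v (t \<cdot>\<^sub>v \<zeta>)) \<xi> = t * scalar_prod (M u w *\<^sub>v \<xi>) \<zeta>"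
          using scalar_prod_mult_smult[OF car[OF w u] \<zeta> \<xi>, of t 1] by (simp add: off)
        ultimately show ?thesis
          using \<open>u \<noteq> w\<close> by (simp add: \<eta>_def)
      qed
      finally show ?thesis
        using psd[unfolded block_psd_def, THEN conjunct2, rule_format, of \<eta>] \<eta> by simp
    qed
    then show "scalar_prod (M u w *\<^sub>v \<xi>) \<zeta> = 0"
      using affine_nonneg_slope_zero by fastforce
  qed (rule car[OF u w])
qed (use diag in simp)

section \<open>Polynomials vanishing on an open set of matrix tuples\<close>

lemma word_eval_line_polynomial:
  assumes A: "A \<in> sym_tuples n" and B: "B \<in> sym_tuples n" and "i < n" "k < n"
  shows "\<exists>P. \<forall>t. word_eval n (\<lambda>v. (1 - t) \<cdot>\<^sub>m A v + t \<cdot>\<^sub>m B v) w $$ (i, k) = poly P t"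
  using \<open>i < n\<close> \<open>k < n\<close>
proof (induction w arbitrary: i)
  case Nil
  show ?case
    by (intro exI[of _ "[:1\<^sub>m n $$ (i, k):]"]) simp
next
  case (Cons v w)
  let ?\<rho> = "\<lambda>t v. (1 - t) \<cdot>\<^sub>m A v + t \<cdot>\<^sub>m B v"
  obtain P where P: "\<And>r t. r < n \<Longrightarrow> word_eval n (?\<rho> t) w $$ (r, k) = poly (P r) t"
    using Cons.IH[OF _ Cons.prems(2)] by metis
  have "word_eval n (?\<rho> t) (v # w) $$ (i, k) =
      poly (\<Sum>r<n. [:A v $$ (i, r), B v $$ (i, r) - A v $$ (i, r):] * P r) t" for t
  proof -
    note W = carrier_matD[OF word_eval_carrier[OF affine_in_sym_tuples[OF A B]], of "1 - t" t w]
    have AB: "dim_row (A v) = n" "dim_col (A v) = n" "dim_row (B v) = n" "dim_col (B v) = n"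
      using sym_tuplesD(1)[OF A, of v] sym_tuplesD(1)[OF B, of v] by auto
    have "word_eval n (?\<rho> t) (v # w) $$ (i, k) =
        (\<Sum>r<n. ((1 - t) * A v $$ (i, r) + t * B v $$ (i, r)) * word_eval n (?\<rho> t) w $$ (r, k))"
      using Cons.prems W AB by (simp add: scalar_prod_def atLeast0LessThan)
    then show ?thesis
      by (simp add: P poly_sum algebra_simps)
  qed
  then show ?case by blast
qed

text \<open>
  Restricted to the line from a point of the open set to \<open>B\<close>, each matrix entry is a polynomial in
  the real parameter; it has infinitely many zeros near the start, hence vanishes at the end.
\<close>

lemma nc_eval_zero_if_zero_on_open:
  fixes U :: "('v::finite \<Rightarrow> real mat) set"
  assumes U: "open_tuples n U" "A \<in> U" and zero: "\<And>A. A \<in> U \<Longrightarrow> nc_eval n A q = 0\<^sub>m n n"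
    and B: "B \<in> sym_tuples n"
  shows "nc_eval n B q = 0\<^sub>m n n"
proof (rule eq_matI)
  have A: "A \<in> sym_tuples n"
    using U by (auto simp: open_tuples_def)
  let ?\<rho> = "\<lambda>t v. (1 - t) \<cdot>\<^sub>m A v + t \<cdot>\<^sub>m B v"
  have \<rho>: "?\<rho> t \<in> sym_tuples n" for t
    by (rule affine_in_sym_tuples[OF A B])
  fix i k assume "i < dim_row (0\<^sub>m n n :: real mat)" "k < dim_col (0\<^sub>m n n :: real mat)"
  then have ik: "i < n" "k < n" by simp_all
  obtain P where P: "\<And>w t. word_eval n (?\<rho> t) w $$ (i, k) = poly (P w) t"
    using word_eval_line_polynomial[OF A B ik] by metis
  define Q where "Q = (\<Sum>w\<in>Poly_Mapping.keys q. Polynomial.smult (Poly_Mapping.lookup q w) (P w))"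
  have Q: "nc_eval n (?\<rho> t) q $$ (i, k) = poly Q t" for t
    by (simp add: nc_eval_index[OF finite_keys subset_refl ik] P Q_def poly_sum)
  obtain \<epsilon> where \<epsilon>: "\<epsilon> > 0" "\<And>D. D \<in> sym_tuples n \<Longrightarrow>
      (\<forall>j. \<forall>i<n. \<forall>k<n. \<bar>D j $$ (i,k) - A j $$ (i,k)\<bar> < \<epsilon>) \<Longrightarrow> D \<in> U"
    using U unfolding open_tuples_def by blast
  \<comment> \<open>A bound \<open>b\<close> on all entries of \<open>B - A\<close> shows how far the line stays inside \<open>U\<close>.\<close>
  define E where "E = (\<lambda>(j, r, s). \<bar>B j $$ (r, s) - A j $$ (r, s)\<bar>) ` (UNIV \<times> {..<n} \<times> {..<n})"
  define b where "b = Max (insert 0 E)"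
  have "finite E"
    by (simp add: E_def)
  then have b: "0 \<le> b" "\<And>j r s. r < n \<Longrightarrow> s < n \<Longrightarrow> \<bar>B j $$ (r, s) - A j $$ (r, s)\<bar> \<le> b"
    unfolding b_def by (auto intro!: Max_ge image_eqI[of _ _ "(_, _, _)"] simp: E_def)
  have "poly Q t = 0" if t: "0 < t" "t < \<epsilon> / (b + 1)" for t
  proof -
    have "t * (b + 1) < \<epsilon>"
      using t b(1) by (simp add: pos_less_divide_eq)
    have "?\<rho> t \<in> U"
    proof (intro \<epsilon>(2) \<rho> allI impI)
      fix j r s assume rs: "r < n" "s < n"
      have "dim_row (A j) = n" "dim_col (A j) = n" "dim_row (B j) = n" "dim_col (B j) = n"
        using sym_tuplesD(1)[OF A, of j] sym_tuplesD(1)[OF B, of j] by auto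
      then have "?\<rho> t j $$ (r, s) - A j $$ (r, s) = t * (B j $$ (r, s) - A j $$ (r, s))"
        using rs by (simp add: algebra_simps)
      then have "\<bar>?\<rho> t j $$ (r, s) - A j $$ (r, s)\<bar> = t * \<bar>B j $$ (r, s) - A j $$ (r, s)\<bar>"
        using t by (simp add: abs_mult)
      also have "\<dots> \<le> t * (b + 1)"
        using b(2)[OF rs, of j] t by (intro mult_left_mono) auto
      finally show "\<bar>?\<rho> t j $$ (r, s) - A j $$ (r, s)\<bar> < \<epsilon>"
        using \<open>t * (b + 1) < \<epsilon>\<close> by simp
    qed
    then show ?thesis
      using zero ik by (simp add: Q[symmetric])
  qed
  then have "{0<..<\<epsilon> / (b + 1)} \<subseteq> {t. poly Q t = 0}"
    by auto
  moreover have "infinite {0<..<\<epsilon> / (b + 1)}"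
    using \<epsilon>(1) b(1) by simp
  ultimately have "Q = 0"
    using poly_roots_finite finite_subset by blast
  moreover have "?\<rho> 1 = B"
  proof
    fix j
    show "?\<rho> 1 j = B j"
      using sym_tuplesD(1)[OF A, of j] sym_tuplesD(1)[OF B, of j] by (intro eq_matI) auto
  qed
  ultimately show "nc_eval n B q $$ (i, k) = 0\<^sub>m n n $$ (i, k)"
    using Q[of 1] ik by simp
qed simp_all

text \<open>
  Adjacency matrices of a labelled path with vertices \<open>0, \<dots>, length s\<close> whose edge from \<open>i\<close> to
  \<open>Suc i\<close> carries the letter \<open>s ! i\<close>. Each letter of a word moves by one vertex along an edge with
  that label, in either direction because the matrices have to be symmetric.
\<close>

definition path_mat :: "nat \<Rightarrow> 'v list \<Rightarrow> 'v \<Rightarrow> real mat" where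
  "path_mat n s v = mat n n (\<lambda>(i, k).
    if (k = Suc i \<and> i < length s \<and> s ! i = v) \<or> (i = Suc k \<and> k < length s \<and> s ! k = v)
    then 1 else 0)"

lemma path_mat_in_sym_tuples: "path_mat n s \<in> sym_tuples n"
  by (auto simp: sym_tuples_def path_mat_def intro!: eq_matI)

text \<open>
  A word of length at most \<open>k - i\<close> can move from \<open>i\<close> to \<open>k\<close> only if it never steps back, and then
  it has to spell the labels on the way.
\<close>

lemma word_eval_path_mat:
  assumes "i + length w \<le> k" "k \<le> length s" "k < n"
  shows "word_eval n (path_mat n s) w $$ (i, k) =
    (if k = i + length w \<and> w = take (length w) (drop i s) then 1 else 0)"
  using assms(1)
proof (induction w arbitrary: i)
  case Nil
  then show ?case using \<open>k < n\<close> by auto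
next
  case (Cons v w)
  let ?W = "word_eval n (path_mat n s) w"
  have W: "?W \<in> carrier_mat n n"
    by (rule word_eval_carrier[OF path_mat_in_sym_tuples])
  have i: "Suc i < n" "i < length s"
    using Cons.prems assms by auto
  have "word_eval n (path_mat n s) (v # w) $$ (i, k) = (\<Sum>r<n. path_mat n s v $$ (i, r) * ?W $$ (r, k))"
    using W i \<open>k < n\<close> by (simp add: path_mat_def scalar_prod_def atLeast0LessThan)
  also have "\<dots> = (\<Sum>r<n. if r = Suc i then (if s ! i = v then ?W $$ (Suc i, k) else 0) else 0)"
  proof (intro sum.cong refl)
    fix r assume "r \<in> {..<n}"
    moreover have "?W $$ (r, k) = 0" if "i = Suc r"
      using Cons.IH[of r] Cons.prems that by auto
    ultimately show "path_mat n s v $$ (i, r) * ?W $$ (r, k) =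
        (if r = Suc i then (if s ! i = v then ?W $$ (Suc i, k) else 0) else 0)"
      using i by (auto simp: path_mat_def)
  qed
  also have "\<dots> = (if s ! i = v then ?W $$ (Suc i, k) else 0)"
    using i by simp
  also have "\<dots> = (if k = i + length (v # w) \<and> v # w = take (length (v # w)) (drop i s) then 1 else 0)"
    using Cons.IH[of "Suc i"] Cons.prems i by (auto simp: Cons_nth_drop_Suc[symmetric])
  finally show ?case .
qed

text \<open>
  The path matrices of a longest word \<open>s\<close> of \<open>q\<close> isolate its coefficient: in the entry that joins
  the two end points, every other word of \<open>q\<close> contributes zero. The path needs only
  \<open>length s + 1\<close> vertices.
\<close>

theorem ncpoly_zero_if_zero_on_open:
  fixes q :: "'v::finite ncpoly"
  assumes U: "open_tuples n U" "U \<noteq> {}" and zero: "\<And>A. A \<in> U \<Longrightarrow> nc_eval n A q = 0\<^sub>m n n"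
    and deg: "\<And>s. s \<in> Poly_Mapping.keys q \<Longrightarrow> length s < n"
  shows "q = 0"
proof (rule ccontr)
  assume "q \<noteq> 0"
  then have "Poly_Mapping.keys q \<noteq> {}" by simp
  define D where "D = Max (length ` Poly_Mapping.keys q)"
  have "D \<in> length ` Poly_Mapping.keys q"
    unfolding D_def using \<open>Poly_Mapping.keys q \<noteq> {}\<close> by (intro Max_in) auto
  then obtain s where s: "s \<in> Poly_Mapping.keys q" "length s = D"
    by auto
  have D: "length w \<le> D" if "w \<in> Poly_Mapping.keys q" for w
    unfolding D_def using that by (intro Max_ge) auto
  have n: "0 < n" "D < n"
    using deg[OF s(1)] s(2) by auto
  obtain A where "A \<in> U" using U by auto
  have "nc_eval n (path_mat n s) q $$ (0, D) =
      (\<Sum>w\<in>Poly_Mapping.keys q. Poly_Mapping.lookup q w * word_eval n (path_mat n s) w $$ (0, D))"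
    by (rule nc_eval_index) (use n in auto)
  also have "\<dots> = (\<Sum>w\<in>Poly_Mapping.keys q. if w = s then Poly_Mapping.lookup q s else 0)"
  proof (intro sum.cong refl)
    fix w assume "w \<in> Poly_Mapping.keys q"
    then have "word_eval n (path_mat n s) w $$ (0, D) = (if D = length w \<and> w = take (length w) s then 1 else 0)"
      using word_eval_path_mat[of 0 w D s n] D s n by auto
    then show "Poly_Mapping.lookup q w * word_eval n (path_mat n s) w $$ (0, D) =
        (if w = s then Poly_Mapping.lookup q s else 0)"
      using s by auto
  qed
  also have "\<dots> = Poly_Mapping.lookup q s"
    using s by simp
  finally have "Poly_Mapping.lookup q s = 0"
    using nc_eval_zero_if_zero_on_open[OF U(1) \<open>A \<in> U\<close> zero path_mat_in_sym_tuples] n by simp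
  then show False
    using s by (simp add: in_keys_iff)
qed

lemma UNIV_var: "(UNIV :: 'g var set) = avars \<union> xvars \<union> range Hvar"
proof -
  have "v \<in> avars \<union> xvars \<union> range Hvar" for v :: "'g var"
    by (cases v) auto
  then show ?thesis by blast
qed

instance var :: (finite) finite
  by standard (simp add: UNIV_var)

text \<open>
  An open set of values for \<open>a\<close> is turned into an open set of values for all letters by leaving the
  other letters free.
\<close>

lemma ncpoly_avars_zero_if_zero_on_open:
  fixes q :: "'g::finite var ncpoly"
  assumes U: "open_tuples n U" "U \<noteq> {}" and X: "X \<in> sym_tuples n"
    and zero: "\<And>A. A \<in> U \<Longrightarrow> eval_ax n q A X = 0\<^sub>m n n"
    and q: "q \<in> ncpolys avars" and deg: "\<And>s. s \<in> Poly_Mapping.keys q \<Longrightarrow> length s < n"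
  shows "q = 0"
proof (rule ncpoly_zero_if_zero_on_open[where U = "{\<rho> \<in> sym_tuples n. (\<lambda>j. \<rho> (Avar j)) \<in> U}"])
  have sub: "U \<subseteq> sym_tuples n"
    using U by (simp add: open_tuples_def)
  show "open_tuples n {\<rho> \<in> sym_tuples n. (\<lambda>j. \<rho> (Avar j)) \<in> U}"
    unfolding open_tuples_def
  proof (intro conjI ballI)
    fix \<rho> assume \<rho>: "\<rho> \<in> {\<rho> \<in> sym_tuples n. (\<lambda>j. \<rho> (Avar j)) \<in> U}"
    then have in_U: "(\<lambda>j. \<rho> (Avar j)) \<in> U"
      by simp
    obtain \<epsilon> where \<epsilon>: "\<epsilon> > 0" "\<And>B. B \<in> sym_tuples n \<Longrightarrow>
        (\<forall>j. \<forall>i<n. \<forall>k<n. \<bar>B j $$ (i,k) - \<rho> (Avar j) $$ (i,k)\<bar> < \<epsilon>) \<Longrightarrow> B \<in> U"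
      using U(1)[unfolded open_tuples_def, THEN conjunct2, THEN bspec[OF _ in_U]] by blast
    show "\<exists>\<epsilon>>0. \<forall>\<sigma>\<in>sym_tuples n. (\<forall>v. \<forall>i<n. \<forall>k<n. \<bar>\<sigma> v $$ (i,k) - \<rho> v $$ (i,k)\<bar> < \<epsilon>) \<longrightarrow>
        \<sigma> \<in> {\<rho> \<in> sym_tuples n. (\<lambda>j. \<rho> (Avar j)) \<in> U}"
    proof (intro exI[of _ \<epsilon>] conjI ballI impI \<epsilon>(1))
      fix \<sigma> :: "'g var \<Rightarrow> real mat"
      assume \<sigma>: "\<sigma> \<in> sym_tuples n" "\<forall>v. \<forall>i<n. \<forall>k<n. \<bar>\<sigma> v $$ (i,k) - \<rho> v $$ (i,k)\<bar> < \<epsilon>"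
      have "(\<lambda>j. \<sigma> (Avar j)) \<in> sym_tuples n"
        using \<sigma>(1) by (simp add: sym_tuples_def)
      then have "(\<lambda>j. \<sigma> (Avar j)) \<in> U"
        using \<sigma>(2) by (intro \<epsilon>(2)) auto
      with \<sigma>(1) show "\<sigma> \<in> {\<rho> \<in> sym_tuples n. (\<lambda>j. \<rho> (Avar j)) \<in> U}"
        by simp
    qed
  qed auto
  obtain A where "A \<in> U" using U by auto
  then have "assign A X X \<in> {\<rho> \<in> sym_tuples n. (\<lambda>j. \<rho> (Avar j)) \<in> U}"
    using sub X by (auto intro: assign_in_sym_tuples)
  then show "{\<rho> \<in> sym_tuples n. (\<lambda>j. \<rho> (Avar j)) \<in> U} \<noteq> {}"
    by blast
  fix \<rho> assume "\<rho> \<in> {\<rho> \<in> sym_tuples n. (\<lambda>j. \<rho> (Avar j)) \<in> U}"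
  then have "eval_ax n q (\<lambda>j. \<rho> (Avar j)) X = 0\<^sub>m n n"
    using zero by blast
  moreover have "nc_eval n \<rho> q = eval_ax n q (\<lambda>j. \<rho> (Avar j)) X"
    using q by (rule nc_eval_cong) auto
  ultimately show "nc_eval n \<rho> q = 0\<^sub>m n n"
    by simp
qed (rule deg)

section \<open>Degrees and coefficients of the middle matrix\<close>

lemma wdeg_simps [simp]:
  "wdeg S [] = 0" "wdeg S (v # w) = (if v \<in> S then 1 else 0) + wdeg S w"
  "wdeg S (u @ w) = wdeg S u + wdeg S w" "wdeg S (rev w) = wdeg S w"
  by (simp_all add: wdeg_def rev_filter[symmetric])

lemma wdeg_le_pdeg: "w \<in> Poly_Mapping.keys p \<Longrightarrow> wdeg S w \<le> pdeg S p"
  unfolding pdeg_def by (intro Max_ge) auto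

lemma pdeg_leI: "(\<And>w. w \<in> Poly_Mapping.keys p \<Longrightarrow> wdeg S w \<le> k) \<Longrightarrow> pdeg S p \<le> k"
  by (simp add: pdeg_def)

lemma pdeg_attained:
  assumes "0 < pdeg S p"
  obtains w where "w \<in> Poly_Mapping.keys p" "wdeg S w = pdeg S p"
proof -
  have "pdeg S p \<in> insert 0 (wdeg S ` Poly_Mapping.keys p)"
    unfolding pdeg_def by (rule Max_in) auto
  with assms that show thesis by auto
qed

lemma map_h_to_x_ident: "m \<in> lists (avars \<union> xvars) \<Longrightarrow> map h_to_x m = m"
  by (induction m) auto

lemma wdeg_range_Hvar_eq_0: "m \<in> lists (avars \<union> xvars) \<Longrightarrow> wdeg (range Hvar) m = 0"
  by (induction m) auto

lemma wdeg_xvars_eq_0_iff: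
  "m \<in> lists (avars \<union> xvars) \<Longrightarrow> wdeg xvars m = 0 \<longleftrightarrow> m \<in> lists avars"
  by (induction m) auto

lemma lists_avarsD:
  assumes "m \<in> lists avars"
  shows "m \<in> lists (avars \<union> xvars)" and "wdeg xvars m = 0" and "map h_to_x m = m"
  using assms by (induction m) auto

lemma borderE:
  assumes "u \<in> border da dx"
  obtains j m where "u = Hvar j # m" "m \<in> border_monos da dx" "m \<in> lists (avars \<union> xvars)"
  using assms by (auto simp: border_def border_monos_def)

text \<open>
  With \<open>d\<^sub>x = 2\<close> the border words have no room for a letter \<open>x\<close>, so \<open>V(a)[h]\<close> is a border vector
  itself.
\<close>

lemma border0_eq_border: "border0 da = border da 2"
proof -
  have "m \<in> lists avars \<and> length m \<le> da \<longleftrightarrow> m \<in> border_monos da 2" for m :: "'g var list"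
  proof
    have "wdeg avars m = length m" if "m \<in> lists avars"
      using that by (induction m) auto
    moreover assume "m \<in> lists avars \<and> length m \<le> da"
    ultimately show "m \<in> border_monos da 2"
      using lists_avarsD[of m] by (simp add: border_monos_def)
  next
    have "wdeg avars m = length m" if "m \<in> lists avars"
      using that by (induction m) auto
    moreover assume "m \<in> border_monos da 2"
    ultimately show "m \<in> lists avars \<and> length m \<le> da"
      using wdeg_xvars_eq_0_iff[of m] by (auto simp: border_monos_def)
  qed
  then show ?thesis
    unfolding border0_def border_def by blast
qed

lemma border_mono: "dx \<le> dx' \<Longrightarrow> border da dx \<subseteq> border da dx'"
  by (fastforce simp: border_def border_monos_def)

lemma lookup_rev_if_nct_eq:
  assumes "nct p = p"
  shows "Poly_Mapping.lookup p (rev w) = Poly_Mapping.lookup p w"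
  by (metis assms lookup_nct)

text \<open>
  Each way of replacing two letters \<open>x\<close> of a word by \<open>h\<close> occurs once with the factor \<open>t\<^sup>2\<close>, whose
  second derivative is two. The symmetry of the middle matrix and all degree bounds on its entries
  are read off from this formula.
\<close>

lemma lookup_middle_matrix:
  fixes p :: "'g::finite var ncpoly"
  assumes p: "p \<in> ncpolys (avars \<union> xvars)"
  defines "B \<equiv> border (pdeg avars p) (pdeg xvars p)"
  shows "Poly_Mapping.lookup (middle_matrix p u w) s =
    (if u \<in> B \<and> w \<in> B \<and> s \<in> lists (avars \<union> xvars)
     then 2 * Poly_Mapping.lookup p (map h_to_x (rev u @ s @ w)) else 0)"
proof -
  have M: "M u w = 0 \<or> u \<in> B \<and> w \<in> B" "\<forall>u\<in>B. \<forall>w\<in>B. M u w \<in> ncpolys (avars \<union> xvars)"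
    "partial_hessian p = sandwich B nc_mono M" if "M = middle_matrix p" for M u w
    using is_middle_matrix_middle_matrix[OF p] that
    unfolding is_middle_matrix_def Let_def B_def by blast+
  let ?Z = "middle_matrix p"
  show ?thesis
  proof (cases "u \<in> B \<and> w \<in> B \<and> s \<in> lists (avars \<union> xvars)")
    case True
    have "Poly_Mapping.lookup (?Z u w) s = Poly_Mapping.lookup (partial_hessian p) (rev u @ s @ w)"
      using lookup_sandwich_border[OF M(2)[OF refl, unfolded B_def]] True
      unfolding M(3)[OF refl] B_def by metis
    moreover have "wdeg (range Hvar) (rev u @ s @ w) = 2"
    proof -
      obtain i m j k where "u = Hvar i # m" "m \<in> lists (avars \<union> xvars)"
        "w = Hvar j # k" "k \<in> lists (avars \<union> xvars)"
        using True unfolding B_def by (metis borderE)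
      then show ?thesis
        using True by (simp add: wdeg_range_Hvar_eq_0)
    qed
    ultimately show ?thesis
      using True by (simp add: lookup_partial_hessian(2)[OF p])
  next
    case False
    have "Poly_Mapping.lookup (?Z u w) s = 0"
    proof (rule ccontr)
      assume "\<not> ?thesis"
      then have "s \<in> Poly_Mapping.keys (?Z u w)" "?Z u w \<noteq> 0"
        by (auto simp: in_keys_iff)
      moreover from this have "u \<in> B" "w \<in> B"
        using M(1)[OF refl] by blast+
      ultimately show False
        using M(2)[OF refl] False unfolding ncpolys_def by blast
    qed
    with False show ?thesis by auto
  qed
qed

lemma middle_matrix_eq_0:
  fixes p :: "'g::finite var ncpoly"
  assumes "p \<in> ncpolys (avars \<union> xvars)"
    and "\<not> (u \<in> border (pdeg avars p) (pdeg xvars p) \<and> w \<in> border (pdeg avars p) (pdeg xvars p))"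
  shows "middle_matrix p u w = 0"
  using assms(2) by (intro poly_mapping_eqI) (auto simp: lookup_middle_matrix[OF assms(1)])

lemma middle_matrix_in_ncpolys:
  fixes p :: "'g::finite var ncpoly"
  assumes "p \<in> ncpolys (avars \<union> xvars)"
  shows "middle_matrix p u w \<in> ncpolys (avars \<union> xvars)"
  by (auto simp: ncpolys_def in_keys_iff lookup_middle_matrix[OF assms] split: if_splits)

lemma nct_middle_matrix:
  fixes p :: "'g::finite var ncpoly"
  assumes p: "p \<in> ncpolys (avars \<union> xvars)" and sym: "nct p = p"
  shows "nct (middle_matrix p u w) = middle_matrix p w u"
proof (rule poly_mapping_eqI)
  fix s
  have "map h_to_x (rev u @ rev s @ w) = rev (map h_to_x (rev w @ s @ u))"
    by (simp add: rev_map)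
  then have "Poly_Mapping.lookup p (map h_to_x (rev u @ rev s @ w)) =
      Poly_Mapping.lookup p (map h_to_x (rev w @ s @ u))"
    using lookup_rev_if_nct_eq[OF sym] by metis
  moreover have "rev s \<in> lists (avars \<union> xvars) \<longleftrightarrow> s \<in> lists (avars \<union> xvars)"
    by (simp add: in_lists_conv_set)
  ultimately show "Poly_Mapping.lookup (nct (middle_matrix p u w)) s =
      Poly_Mapping.lookup (middle_matrix p w u) s"
    by (simp only: lookup_nct lookup_middle_matrix[OF p]) auto
qed

text \<open>
  A word \<open>s\<close> of the entry comes from the word \<open>m\<^sup>T x\<^sub>i s x\<^sub>j k\<close> of \<open>p\<close>, whose degrees are bounded by
  those of \<open>p\<close>.
\<close>

lemma keys_middle_matrix:
  fixes p :: "'g::finite var ncpoly"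
  assumes p: "p \<in> ncpolys (avars \<union> xvars)"
    and s: "s \<in> Poly_Mapping.keys (middle_matrix p (Hvar i # m) (Hvar j # k))"
  shows "wdeg xvars m + wdeg xvars s + wdeg xvars k + 2 \<le> pdeg xvars p"
    and "length s < pdeg UNIV p" and "s \<in> lists (avars \<union> xvars)"
proof -
  let ?B = "border (pdeg avars p) (pdeg xvars p)"
  let ?y = "rev m @ Xvar i # s @ Xvar j # k"
  have *: "Hvar i # m \<in> ?B" "Hvar j # k \<in> ?B" "s \<in> lists (avars \<union> xvars)"
    "map h_to_x (rev (Hvar i # m) @ s @ Hvar j # k) \<in> Poly_Mapping.keys p"
    using s by (auto simp: in_keys_iff lookup_middle_matrix[OF p] split: if_splits)
  have "m \<in> lists (avars \<union> xvars)" "k \<in> lists (avars \<union> xvars)"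
    using *(1,2) by (auto elim!: borderE)
  then have "?y \<in> Poly_Mapping.keys p"
    using *(3,4) by (simp add: map_h_to_x_ident rev_map[symmetric])
  then have "wdeg xvars ?y \<le> pdeg xvars p" "wdeg UNIV ?y \<le> pdeg UNIV p"
    by (simp_all add: wdeg_le_pdeg del: wdeg_simps)
  moreover have "wdeg UNIV ?y = length ?y"
    by (simp add: wdeg_def)
  ultimately show "wdeg xvars m + wdeg xvars s + wdeg xvars k + 2 \<le> pdeg xvars p"
    "length s < pdeg UNIV p"
    by auto
qed (use s in \<open>auto simp: in_keys_iff lookup_middle_matrix[OF p] split: if_splits\<close>)

lemma split_last_xvar:
  assumes "y \<in> lists (avars \<union> xvars)" "wdeg xvars y \<noteq> 0"
  obtains r i s where "y = r @ Xvar i # s" "r \<in> lists (avars \<union> xvars)" "s \<in> lists avars"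
proof -
  have "\<exists>v\<in>set y. v \<in> xvars"
    using assms(2) by (auto simp: wdeg_def filter_empty_conv)
  then obtain r v s where y: "y = r @ v # s" "v \<in> xvars" "\<forall>z\<in>set s. z \<notin> xvars"
    using split_list_last_prop[of y "\<lambda>v. v \<in> xvars"] by blast
  then obtain i where "v = Xvar i" by blast
  moreover have "s \<in> lists avars" "r \<in> lists (avars \<union> xvars)"
    using y assms(1) unfolding in_lists_conv_set y(1) set_append by (simp_all, blast)
  ultimately show thesis
    using y(1) that by blast
qed

text \<open>
  A word of \<open>p\<close> with the maximal number \<open>d\<^sub>x\<close> of letters \<open>x\<close> is cut at its last two: it becomes
  \<open>r x\<^sub>i s x\<^sub>j k\<close> with \<open>s\<close> and \<open>k\<close> free of \<open>x\<close>. The border word \<open>u = h\<^sub>i r\<^sup>T\<close> has the largest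
  possible degree \<open>d\<^sub>x - 2\<close> in \<open>x\<close>, so for \<open>d\<^sub>x > 2\<close> the diagonal entry at \<open>u\<close> vanishes for
  reasons of degree, and by positivity so does the whole row of \<open>u\<close> at \<open>(A, chi)\<close>. The entry at
  \<open>u\<close> and \<open>w = h\<^sub>j k\<close> is again by degree a polynomial in \<open>a\<close> alone, so it is the zero polynomial,
  although its coefficient at \<open>s\<close> comes from the chosen word.
\<close>

lemma pdeg_xvars_le_2_if_block_psd:
  fixes p :: "'g::finite var ncpoly"
  assumes p: "p \<in> ncpolys (avars \<union> xvars)"
    and n: "pdeg UNIV p \<le> n" and U: "open_tuples n U" "U \<noteq> {}" and chi: "chi \<in> sym_tuples n"
    and psd: "\<And>A. A \<in> U \<Longrightarrow> block_psd n (border (pdeg avars p) (pdeg xvars p))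
      (\<lambda>u w. eval_ax n (middle_matrix p u w) A chi)"
  shows "pdeg xvars p \<le> 2"
proof (rule ccontr)
  assume "\<not> pdeg xvars p \<le> 2"
  then have dx: "2 < pdeg xvars p" by simp
  let ?B = "border (pdeg avars p) (pdeg xvars p)" and ?Z = "middle_matrix p"
  obtain y where y: "y \<in> Poly_Mapping.keys p" "wdeg xvars y = pdeg xvars p"
    using pdeg_attained[of xvars p] dx by auto
  have y_ax: "y \<in> lists (avars \<union> xvars)"
    using y(1) p unfolding ncpolys_def by blast
  have "wdeg xvars y \<noteq> 0"
    using y(2) dx by simp
  with y_ax obtain y' j k
    where y': "y = y' @ Xvar j # k" "y' \<in> lists (avars \<union> xvars)" "k \<in> lists avars"
    by (rule split_last_xvar)
  have k: "k \<in> lists (avars \<union> xvars)" "wdeg xvars k = 0"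
    by (rule lists_avarsD[OF y'(3)])+
  have "wdeg xvars y' \<noteq> 0"
    using y(2) dx k(2) by (auto simp: y'(1))
  with y'(2) obtain r i s
    where r: "y' = r @ Xvar i # s" "r \<in> lists (avars \<union> xvars)" "s \<in> lists avars"
    by (rule split_last_xvar)
  have s: "s \<in> lists (avars \<union> xvars)" "wdeg xvars s = 0"
    by (rule lists_avarsD[OF r(3)])+
  have y_eq: "y = r @ Xvar i # s @ Xvar j # k"
    by (simp add: y'(1) r(1))
  have rx: "wdeg xvars r + 2 = pdeg xvars p"
    using y(2) s(2) k(2) by (simp add: y_eq)
  have rev_r: "rev r \<in> lists (avars \<union> xvars)"
    using r(2) by (simp add: in_lists_conv_set)
  have "wdeg avars y \<le> pdeg avars p"
    using y(1) by (rule wdeg_le_pdeg)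
  then have border: "Hvar i # rev r \<in> ?B" "Hvar j # k \<in> ?B"
    unfolding border_def border_monos_def mem_Collect_eq
    using rx dx k rev_r by (simp_all add: y_eq)
  have "s' \<notin> Poly_Mapping.keys (?Z (Hvar i # rev r) (Hvar i # rev r))" for s'
    using keys_middle_matrix(1)[OF p, of s' i "rev r" i "rev r"] rx dx by auto
  then have "Poly_Mapping.keys (?Z (Hvar i # rev r) (Hvar i # rev r)) = {}"
    by blast
  then have "?Z (Hvar i # rev r) (Hvar i # rev r) = 0"
    by simp
  then have zero: "eval_ax n (?Z (Hvar i # rev r) (Hvar j # k)) A chi = 0\<^sub>m n n" if "A \<in> U" for A
    using block_psd_zero_diagonal[OF psd[OF that] finite_border border] by (simp add: nc_eval_zero)
  have keys: "t \<in> lists avars" "length t < n"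
    if "t \<in> Poly_Mapping.keys (?Z (Hvar i # rev r) (Hvar j # k))" for t
  proof -
    have "wdeg xvars t = 0"
      using keys_middle_matrix(1)[OF p that] rx by simp
    then show "t \<in> lists avars"
      using keys_middle_matrix(3)[OF p that] wdeg_xvars_eq_0_iff by blast
    show "length t < n"
      using keys_middle_matrix(2)[OF p that] n by simp
  qed
  have in_avars: "?Z (Hvar i # rev r) (Hvar j # k) \<in> ncpolys avars"
    unfolding ncpolys_def using keys(1) by blast
  have "?Z (Hvar i # rev r) (Hvar j # k) = 0"
    by (rule ncpoly_avars_zero_if_zero_on_open[OF U chi zero in_avars keys(2)])
  then have "Poly_Mapping.lookup (?Z (Hvar i # rev r) (Hvar j # k)) s = 0"
    by simp
  then have "Poly_Mapping.lookup p y = 0"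
    using border s(1) r(2) k(1)
    by (simp add: lookup_middle_matrix[OF p] y_eq map_h_to_x_ident)
  then show False
    using y(1) by (simp add: in_keys_iff)
qed

section \<open>Polynomials of degree at most two in x\<close>

text \<open>
  The two letters \<open>h\<close> of a word of the Hessian already account for the degree two in \<open>x\<close> of the word
  of \<open>p\<close> from which it comes.
\<close>

lemma middle_matrix_in_ncpolys_avars:
  fixes p :: "'g::finite var ncpoly"
  assumes p: "p \<in> ncpolys (avars \<union> xvars)" and dx: "pdeg xvars p \<le> 2"
  shows "middle_matrix p u w \<in> ncpolys avars"
proof (cases "u \<in> border (pdeg avars p) (pdeg xvars p) \<and> w \<in> border (pdeg avars p) (pdeg xvars p)")
  case True
  then obtain i m j k where uw: "u = Hvar i # m" "w = Hvar j # k"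
    by (metis borderE)
  show ?thesis
    unfolding ncpolys_def mem_Collect_eq
  proof
    fix s assume "s \<in> Poly_Mapping.keys (middle_matrix p u w)"
    then have s: "s \<in> Poly_Mapping.keys (middle_matrix p (Hvar i # m) (Hvar j # k))"
      by (simp add: uw)
    have "wdeg xvars s = 0"
      using keys_middle_matrix(1)[OF p s] dx by simp
    then show "s \<in> lists avars"
      using keys_middle_matrix(3)[OF p s] wdeg_xvars_eq_0_iff by blast
  qed
next
  case False
  then show ?thesis
    by (simp add: middle_matrix_eq_0[OF p] ncpolys_def)
qed

lemma sandwich_superset:
  assumes "B \<subseteq> I" "finite I" "\<And>u w. \<not> (u \<in> B \<and> w \<in> B) \<Longrightarrow> M u w = 0"
  shows "sandwich I e M = sandwich B e M"
proof -
  have "sandwich I e M = (\<Sum>u\<in>B. \<Sum>w\<in>I. nct (e u) * M u w * e w)"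
    unfolding sandwich_def using assms by (intro sum.mono_neutral_right) (auto intro!: sum.neutral)
  also have "\<dots> = sandwich B e M"
    unfolding sandwich_def using assms by (intro sum.cong refl sum.mono_neutral_right) auto
  finally show ?thesis .
qed

lemma block_psd_superset:
  assumes psd: "block_psd n B M" and B: "B \<subseteq> I" "finite I"
    and zero: "\<And>u w. \<not> (u \<in> B \<and> w \<in> B) \<Longrightarrow> M u w = 0\<^sub>m n n"
  shows "block_psd n I M"
  unfolding block_psd_def
proof (intro conjI ballI allI impI)
  fix u w
  show "M u w \<in> carrier_mat n n" "transpose_mat (M u w) = M w u"
    using psd zero[of u w] zero[of w u] by (cases "u \<in> B \<and> w \<in> B"; auto simp: block_psd_def)+
next
  fix \<xi> :: "_ \<Rightarrow> real vec" assume \<xi>: "\<forall>u\<in>I. \<xi> u \<in> carrier_vec n"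
  have z: "scalar_prod (M u w *\<^sub>v \<xi> w) (\<xi> u) = 0" if "u \<in> I" "w \<in> I" "\<not> (u \<in> B \<and> w \<in> B)" for u w
    using that \<xi> zero[OF that(3)] by (simp add: scalar_prod_mult_mat_vec[of _ n n])
  have "(\<Sum>u\<in>I. \<Sum>w\<in>I. scalar_prod (M u w *\<^sub>v \<xi> w) (\<xi> u)) =
      (\<Sum>u\<in>B. \<Sum>w\<in>I. scalar_prod (M u w *\<^sub>v \<xi> w) (\<xi> u))"
    using B by (intro sum.mono_neutral_right) (auto intro!: sum.neutral z)
  also have "\<dots> = (\<Sum>u\<in>B. \<Sum>w\<in>B. scalar_prod (M u w *\<^sub>v \<xi> w) (\<xi> u))"
    using B by (intro sum.cong refl sum.mono_neutral_right) (auto intro!: z)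
  finally show "0 \<le> (\<Sum>u\<in>I. \<Sum>w\<in>I. scalar_prod (M u w *\<^sub>v \<xi> w) (\<xi> u))"
    using psd \<xi> B by (auto simp: block_psd_def subset_iff)
qed

text \<open>
  On words without \<open>x\<close>, \<open>h_to_x\<close> agrees with this involution. Being invertible, it allows
  coefficients of \<open>V(a)[x]\<^sup>T Z V(a)[x]\<close> to be pulled back to those of the Hessian.
\<close>

fun swap_xh :: "'g var \<Rightarrow> 'g var" where
  "swap_xh (Avar j) = Avar j"
| "swap_xh (Xvar j) = Hvar j"
| "swap_xh (Hvar j) = Xvar j"

lemma swap_xh_swap_xh [simp]: "swap_xh (swap_xh v) = v"
  by (cases v) auto

lemma map_swap_xh_twice [simp]: "map swap_xh (map swap_xh w) = w"
  by (induction w) auto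

lemma map_swap_xh_avars: "m \<in> lists avars \<Longrightarrow> map swap_xh m = m"
  by (induction m) auto

lemma map_swap_xh_border0:
  assumes "u \<in> border0 da"
  shows "map swap_xh u = map h_to_x u"
proof -
  obtain j m where u: "u = Hvar j # m" "m \<in> lists avars"
    using assms by (auto simp: border0_def)
  then show ?thesis
    by (simp add: map_swap_xh_avars lists_avarsD(3))
qed

lemma lookup_sandwich_border0_h_to_x:
  fixes Z :: "'g::finite var list \<Rightarrow> 'g var list \<Rightarrow> 'g var ncpoly"
  assumes Z: "\<And>u w. Z u w \<in> ncpolys avars"
  shows "Poly_Mapping.lookup (sandwich (border0 da) (\<lambda>w. nc_mono (map h_to_x w)) Z) y =
    Poly_Mapping.lookup (sandwich (border0 da) nc_mono Z) (map swap_xh y)"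
  unfolding sandwich_def lookup_sum nct_nc_mono
proof (intro sum.cong refl)
  fix u w :: "'g var list" assume "u \<in> border0 da" "w \<in> border0 da"
  then have u: "map h_to_x u = map swap_xh u" and w: "map h_to_x w = map swap_xh w"
    by (simp_all add: map_swap_xh_border0)
  have lists: "s \<in> lists avars" if "Poly_Mapping.lookup (Z u w) s \<noteq> 0" for s
    using that Z[of u w] by (auto simp: ncpolys_def in_keys_iff)
  show "Poly_Mapping.lookup (nc_mono (rev (map h_to_x u)) * Z u w * nc_mono (map h_to_x w)) y =
      Poly_Mapping.lookup (nc_mono (rev u) * Z u w * nc_mono w) (map swap_xh y)"
  proof (cases "\<exists>s\<in>lists avars. y = map swap_xh (rev u @ s @ w)")
    case True
    then obtain s where s: "s \<in> lists avars" "y = map swap_xh (rev u @ s @ w)"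
      by blast
    then have "map swap_xh y = rev u @ s @ w"
      by (simp only: map_swap_xh_twice)
    moreover have "y = rev (map swap_xh u) @ s @ map swap_xh w"
      by (simp add: s(2) rev_map map_swap_xh_avars[OF s(1)])
    ultimately show ?thesis
      by (simp only: u w lookup_nc_mono_mult_nc_mono)
  next
    case False
    have "Poly_Mapping.lookup (nc_mono (rev (map h_to_x u)) * Z u w * nc_mono (map h_to_x w)) y = 0"
    proof (rule ccontr)
      assume "\<not> ?thesis"
      then obtain s where s: "y = rev (map h_to_x u) @ s @ map h_to_x w" "s \<in> lists avars"
        using lookup_nc_mono_mult_nc_mono_nz lists by blast
      then have "y = map swap_xh (rev u @ s @ w)"
        by (simp add: u w rev_map map_swap_xh_avars)
      with s(2) False show False by blast
    qed
    moreover have "Poly_Mapping.lookup (nc_mono (rev u) * Z u w * nc_mono w) (map swap_xh y) = 0"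
    proof (rule ccontr)
      assume "\<not> ?thesis"
      then obtain s where s: "map swap_xh y = rev u @ s @ w" "s \<in> lists avars"
        using lookup_nc_mono_mult_nc_mono_nz lists by blast
      then have "y = map swap_xh (rev u @ s @ w)"
        by (metis map_swap_xh_twice)
      with s(2) False show False by blast
    qed
    ultimately show ?thesis by simp
  qed
qed

lemma partial_hessian_eq_sandwich_border0:
  fixes p :: "'g::finite var ncpoly"
  assumes p: "p \<in> ncpolys (avars \<union> xvars)" and dx: "pdeg xvars p \<le> 2"
  shows "partial_hessian p = sandwich (border0 (pdeg avars p)) nc_mono (middle_matrix p)"
proof -
  have "sandwich (border0 (pdeg avars p)) nc_mono (middle_matrix p) =
      sandwich (border (pdeg avars p) (pdeg xvars p)) nc_mono (middle_matrix p)"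
    by (intro sandwich_superset middle_matrix_eq_0[OF p])
      (simp_all add: border0_eq_border border_mono[OF dx] finite_border)
  then show ?thesis
    using is_middle_matrix_middle_matrix[OF p] by (simp add: is_middle_matrix_def Let_def)
qed

text \<open>
  So half of \<open>V(a)[x]\<^sup>T Z V(a)[x]\<close> is the part of \<open>p\<close> that is homogeneous of degree two in \<open>x\<close>.
\<close>

lemma lookup_sandwich_middle_matrix:
  fixes p :: "'g::finite var ncpoly"
  assumes p: "p \<in> ncpolys (avars \<union> xvars)" and dx: "pdeg xvars p \<le> 2"
  shows "Poly_Mapping.lookup
      (sandwich (border0 (pdeg avars p)) (\<lambda>w. nc_mono (map h_to_x w)) (middle_matrix p)) y =
    (if wdeg xvars y = 2 then 2 * Poly_Mapping.lookup p y else 0)"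
proof -
  have deg: "wdeg (range Hvar) (map swap_xh y) = wdeg xvars y"
  proof (induction y)
    case (Cons v y)
    then show ?case by (cases v) auto
  qed simp
  have "Poly_Mapping.lookup p (map h_to_x (map swap_xh y)) = Poly_Mapping.lookup p y"
    if two: "wdeg xvars y = 2"
  proof (cases "y \<in> lists (avars \<union> xvars)")
    case True
    then have "map h_to_x (map swap_xh y) = y"
      by (induction y) auto
    then show ?thesis by simp
  next
    case False
    have "wdeg xvars y + wdeg (range Hvar) y = wdeg xvars (map h_to_x (map swap_xh y))"
    proof (induction y)
      case (Cons v y)
      then show ?case by (cases v) auto
    qed simp
    moreover have "wdeg (range Hvar) y \<noteq> 0"
    proof -
      obtain v where "v \<in> set y" "v \<notin> avars \<union> xvars"
        using False by (auto simp: in_lists_conv_set)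
      moreover from this(2) have "v \<in> range Hvar"
        by (cases v) auto
      ultimately show ?thesis
        unfolding wdeg_def length_0_conv filter_empty_conv by blast
    qed
    ultimately have "\<not> wdeg xvars (map h_to_x (map swap_xh y)) \<le> pdeg xvars p"
      using two dx by simp
    then have "map h_to_x (map swap_xh y) \<notin> Poly_Mapping.keys p"
      using wdeg_le_pdeg by blast
    moreover have "y \<notin> Poly_Mapping.keys p"
      using False p by (auto simp: ncpolys_def)
    ultimately show ?thesis
      by (simp add: in_keys_iff)
  qed
  then show ?thesis
    using lookup_sandwich_border0_h_to_x[OF middle_matrix_in_ncpolys_avars[OF p dx]]
    by (simp add: partial_hessian_eq_sandwich_border0[OF p dx, symmetric]
        lookup_partial_hessian(2)[OF p] deg del: map_map)
qed

section \<open>Convexity\<close>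

lemma word_eval_no_xvars:
  assumes "w \<in> lists avars"
  shows "word_eval n (assign A X G) w = word_eval n (assign A Y G) w"
  using assms by (intro word_eval_cong) auto

lemma word_eval_Cons_index:
  assumes "\<rho> \<in> sym_tuples n" "i < n" "k < n"
  shows "word_eval n \<rho> (v # w) $$ (i, k) = (\<Sum>r<n. \<rho> v $$ (i, r) * word_eval n \<rho> w $$ (r, k))"
  using assms carrier_matD[OF sym_tuplesD(1)[OF assms(1), of v]]
    carrier_matD[OF word_eval_carrier[OF assms(1), of w]]
  by (simp add: scalar_prod_def atLeast0LessThan)

lemma combination_index:
  assumes "X \<in> sym_tuples n" "Y \<in> sym_tuples n" "i < n" "k < n"
  shows "(s \<cdot>\<^sub>m X j + t \<cdot>\<^sub>m Y j) $$ (i, k) = s * X j $$ (i, k) + t * Y j $$ (i, k)"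
  using assms carrier_matD[OF sym_tuplesD(1)[OF assms(1), of j]]
    carrier_matD[OF sym_tuplesD(1)[OF assms(2), of j]] by simp

lemma word_eval_linear_in_x:
  assumes A: "A \<in> sym_tuples n" and X: "X \<in> sym_tuples n" and Y: "Y \<in> sym_tuples n"
    and G: "G \<in> sym_tuples n"
    and w: "w \<in> lists (avars \<union> xvars)" "wdeg xvars w = 1" and ik: "i < n" "k < n"
  shows "word_eval n (assign A (\<lambda>j. s \<cdot>\<^sub>m X j + t \<cdot>\<^sub>m Y j) G) w $$ (i, k) =
    s * word_eval n (assign A X G) w $$ (i, k) + t * word_eval n (assign A Y G) w $$ (i, k)"
  using w ik(1)
proof (induction w arbitrary: i rule: list.induct)
  case (Cons v w)
  note idx = word_eval_Cons_index[OF assign_in_sym_tuples[OF A _ G] Cons.prems(3) ik(2)]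
  note idxs = idx[OF affine_in_sym_tuples[OF X Y]] idx[OF X] idx[OF Y]
  consider (A) j where "v = Avar j" | (X) j where "v = Xvar j"
    using Cons.prems(1) by auto
  then show ?case
  proof cases
    case A
    then have IH: "word_eval n (assign A (\<lambda>j. s \<cdot>\<^sub>m X j + t \<cdot>\<^sub>m Y j) G) w $$ (r, k) =
      s * word_eval n (assign A X G) w $$ (r, k) + t * word_eval n (assign A Y G) w $$ (r, k)"
      if "r < n" for r
      using Cons.IH[OF _ _ that] Cons.prems by (auto simp: image_iff)
    show ?thesis
      unfolding idxs sum_distrib_left sum.distrib[symmetric]
      by (intro sum.cong refl) (simp add: A IH algebra_simps)
  next
    case X
    then have "w \<in> lists avars"
      using Cons.prems by (auto simp: wdeg_xvars_eq_0_iff)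
    note W = word_eval_no_xvars[OF this, of n A _ G X]
    show ?thesis
      unfolding idxs sum_distrib_left sum.distrib[symmetric]
      by (intro sum.cong refl)
        (simp add: X W[of Y] W[of "\<lambda>j. s \<cdot>\<^sub>m X j + t \<cdot>\<^sub>m Y j"]
          combination_index[OF \<open>X \<in> sym_tuples n\<close> Y Cons.prems(3)] algebra_simps
          del: index_add_mat index_smult_mat)
  qed
qed simp

text \<open>
  Words of degree at most one in \<open>x\<close> are affine in \<open>X\<close> and have no gap. For degree two this is the
  noncommutative form of \<open>t x\<^sup>2 + (1 - t) y\<^sup>2 - (t x + (1 - t) y)\<^sup>2 = t (1 - t) (x - y)\<^sup>2\<close>; the
  difference \<open>X - Y\<close> is written as a linear combination to match the affine combination in shape.
\<close>

lemma word_eval_convexity_gap: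
  assumes A: "A \<in> sym_tuples n" and X: "X \<in> sym_tuples n" and Y: "Y \<in> sym_tuples n"
    and G: "G \<in> sym_tuples n"
    and w: "w \<in> lists (avars \<union> xvars)" "wdeg xvars w \<le> 2" and ik: "i < n" "k < n"
  shows "t * word_eval n (assign A X G) w $$ (i, k) + (1 - t) * word_eval n (assign A Y G) w $$ (i, k) -
      word_eval n (assign A (\<lambda>j. t \<cdot>\<^sub>m X j + (1 - t) \<cdot>\<^sub>m Y j) G) w $$ (i, k) =
    (if wdeg xvars w = 2
     then t * (1 - t) * word_eval n (assign A (\<lambda>j. 1 \<cdot>\<^sub>m X j + (-1) \<cdot>\<^sub>m Y j) G) w $$ (i, k) else 0)"
proof -
  consider "wdeg xvars w = 0" | "wdeg xvars w = 1" | "wdeg xvars w = 2"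
    using w(2) by linarith
  then show ?thesis
  proof cases
    case 1
    then have "w \<in> lists avars"
      using w(1) wdeg_xvars_eq_0_iff by blast
    note W = word_eval_no_xvars[OF this, of n A _ G X]
    show ?thesis
      using 1 by (simp add: W[of Y] W[of "\<lambda>j. t \<cdot>\<^sub>m X j + (1 - t) \<cdot>\<^sub>m Y j"] algebra_simps)
  next
    case 2
    then show ?thesis
      by (simp add: word_eval_linear_in_x[OF A X Y G w(1) _ ik])
  next
    case 3
    have "t * word_eval n (assign A X G) w $$ (i, k) + (1 - t) * word_eval n (assign A Y G) w $$ (i, k) -
      word_eval n (assign A (\<lambda>j. t \<cdot>\<^sub>m X j + (1 - t) \<cdot>\<^sub>m Y j) G) w $$ (i, k) =
      t * (1 - t) * word_eval n (assign A (\<lambda>j. 1 \<cdot>\<^sub>m X j + (-1) \<cdot>\<^sub>m Y j) G) w $$ (i, k)"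
      using w(1) 3 ik(1)
    proof (induction w arbitrary: i rule: list.induct)
      case (Cons v w)
      note idx = word_eval_Cons_index[OF assign_in_sym_tuples[OF A _ G] Cons.prems(3) ik(2)]
      note idxs = idx[OF affine_in_sym_tuples[OF X Y]] idx[OF X] idx[OF Y]
      consider (A) j where "v = Avar j" | (X) j where "v = Xvar j"
        using Cons.prems(1) by auto
      then show ?case
      proof cases
        case A
        then have IH: "t * word_eval n (assign A X G) w $$ (r, k) + (1 - t) * word_eval n (assign A Y G) w $$ (r, k) -
          word_eval n (assign A (\<lambda>j. t \<cdot>\<^sub>m X j + (1 - t) \<cdot>\<^sub>m Y j) G) w $$ (r, k) =
          t * (1 - t) * word_eval n (assign A (\<lambda>j. 1 \<cdot>\<^sub>m X j + (-1) \<cdot>\<^sub>m Y j) G) w $$ (r, k)"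
          if "r < n" for r
          using Cons.IH[OF _ _ that] Cons.prems by (auto simp: image_iff)
        have IH': "word_eval n (assign A (\<lambda>j. t \<cdot>\<^sub>m X j + (1 - t) \<cdot>\<^sub>m Y j) G) w $$ (r, k) =
          t * word_eval n (assign A X G) w $$ (r, k) + (1 - t) * word_eval n (assign A Y G) w $$ (r, k) -
          t * (1 - t) * word_eval n (assign A (\<lambda>j. 1 \<cdot>\<^sub>m X j + (-1) \<cdot>\<^sub>m Y j) G) w $$ (r, k)"
          if "r < n" for r
          using IH[OF that] by linarith
        show ?thesis
          unfolding idxs sum_distrib_left sum.distrib[symmetric] sum_subtractf[symmetric]
          by (intro sum.cong refl) (simp add: A IH' algebra_simps)
      next
        case X
        then have "w \<in> lists (avars \<union> xvars)" "wdeg xvars w = 1"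
          using Cons.prems by auto
        note lin = word_eval_linear_in_x[OF A \<open>X \<in> sym_tuples n\<close> Y G this _ ik(2)]
        show ?thesis
          unfolding idxs sum_distrib_left sum.distrib[symmetric] sum_subtractf[symmetric]
          by (intro sum.cong refl)
            (simp add: X lin combination_index[OF \<open>X \<in> sym_tuples n\<close> Y Cons.prems(3)] algebra_simps
              del: index_add_mat index_smult_mat)
      qed
    qed simp
    with 3 show ?thesis by simp
  qed
qed

lemma nc_eval_convexity_gap:
  assumes A: "A \<in> sym_tuples n" and X: "X \<in> sym_tuples n" and Y: "Y \<in> sym_tuples n"
    and p: "p \<in> ncpolys (avars \<union> xvars)" and dx: "pdeg xvars p \<le> 2"
    and q: "\<And>y. Poly_Mapping.lookup q y = (if wdeg xvars y = 2 then Poly_Mapping.lookup p y else 0)"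
  shows "t \<cdot>\<^sub>m eval_ax n p A X + (1 - t) \<cdot>\<^sub>m eval_ax n p A Y
      - eval_ax n p A (\<lambda>j. t \<cdot>\<^sub>m X j + (1 - t) \<cdot>\<^sub>m Y j) =
    (t * (1 - t)) \<cdot>\<^sub>m eval_ax n q A (\<lambda>j. 1 \<cdot>\<^sub>m X j + (-1) \<cdot>\<^sub>m Y j)" (is "?L = ?R")
proof (rule eq_matI)
  fix i k assume "i < dim_row ?R" "k < dim_col ?R"
  then have ik: "i < n" "k < n" by simp_all
  let ?K = "Poly_Mapping.keys p" and ?w = "\<lambda>X w. word_eval n (assign A X (zero_tuple n)) w $$ (i, k)"
  let ?T = "\<lambda>j. t \<cdot>\<^sub>m X j + (1 - t) \<cdot>\<^sub>m Y j" and ?D = "\<lambda>j. 1 \<cdot>\<^sub>m X j + (-1) \<cdot>\<^sub>m Y j"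
  have sub: "Poly_Mapping.keys q \<subseteq> ?K"
    by (auto simp: in_keys_iff q split: if_splits)
  have "?L $$ (i, k) = t * (\<Sum>w\<in>?K. Poly_Mapping.lookup p w * ?w X w)
      + (1 - t) * (\<Sum>w\<in>?K. Poly_Mapping.lookup p w * ?w Y w)
      - (\<Sum>w\<in>?K. Poly_Mapping.lookup p w * ?w ?T w)"
    using ik by (simp add: nc_eval_index[of ?K])
  also have "\<dots> = (\<Sum>w\<in>?K. Poly_Mapping.lookup p w * (t * ?w X w + (1 - t) * ?w Y w - ?w ?T w))"
    unfolding sum_distrib_left sum.distrib[symmetric] sum_subtractf[symmetric]
    by (intro sum.cong refl) (simp add: algebra_simps)
  also have "\<dots> = (\<Sum>w\<in>?K. t * (1 - t) * (Poly_Mapping.lookup q w * ?w ?D w))"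
  proof (intro sum.cong refl)
    fix w assume w: "w \<in> ?K"
    have "w \<in> lists (avars \<union> xvars)"
      using p w unfolding ncpolys_def by blast
    moreover have "wdeg xvars w \<le> 2"
      using wdeg_le_pdeg[OF w, of xvars] dx by simp
    ultimately show "Poly_Mapping.lookup p w * (t * ?w X w + (1 - t) * ?w Y w - ?w ?T w) =
        t * (1 - t) * (Poly_Mapping.lookup q w * ?w ?D w)"
      by (simp only: word_eval_convexity_gap[OF A X Y zero_tuple_in_sym_tuples _ _ ik] q) simp
  qed
  also have "\<dots> = ?R $$ (i, k)"
    using ik by (simp add: nc_eval_index[OF finite_keys sub] sum_distrib_left)
  finally show "?L $$ (i, k) = ?R $$ (i, k)" .
qed simp_all

lemma nc_eval_form_const_mult:
  assumes "\<rho> \<in> sym_tuples n" "\<xi> \<in> carrier_vec n" "\<zeta> \<in> carrier_vec n"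
  shows "scalar_prod (nc_eval n \<rho> (nc_const c * q) *\<^sub>v \<xi>) \<zeta> = c * scalar_prod (nc_eval n \<rho> q *\<^sub>v \<xi>) \<zeta>"
proof -
  have sub: "Poly_Mapping.keys (nc_const c * q) \<subseteq> Poly_Mapping.keys q"
    by (auto simp: in_keys_iff lookup_nc_const_mult)
  show ?thesis
    unfolding nc_eval_form[OF assms(1) finite_keys sub assms(2,3)]
      nc_eval_form[OF assms(1) finite_keys subset_refl assms(2,3), of q]
    by (simp add: lookup_nc_const_mult sum_distrib_left mult.assoc)
qed

text \<open>
  The convexity gap is \<open>t (1 - t)\<close> times the value at \<open>X - Y\<close> of the part \<open>q\<close> of degree two, and the
  form of \<open>q\<close> is half the form of the middle matrix on the blocks \<open>V(A)[X - Y] \<xi>\<close>.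
\<close>

lemma globally_convex_if_block_psd:
  fixes p :: "'g::finite var ncpoly"
  assumes p: "p \<in> ncpolys (avars \<union> xvars)" and sym: "nct p = p" and dx: "pdeg xvars p \<le> 2"
    and A: "A \<in> sym_tuples n"
    and psd: "block_psd n (border0 (pdeg avars p))
      (\<lambda>u w. eval_ax n (middle_matrix p u w) A (zero_tuple n))"
  shows "globally_convex n (eval_ax n p A)"
  unfolding globally_convex_def
proof (intro ballI allI impI)
  fix X Y :: "'g \<Rightarrow> real mat" and t :: real
  assume X: "X \<in> sym_tuples n" and Y: "Y \<in> sym_tuples n" and t: "0 < t \<and> t < 1"
  let ?I = "border0 (pdeg avars p) :: 'g var list set" and ?Z = "middle_matrix p"
  define q where "q = nc_const (1/2) * sandwich ?I (\<lambda>w. nc_mono (map h_to_x w)) ?Z"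
  have q: "Poly_Mapping.lookup q y = (if wdeg xvars y = 2 then Poly_Mapping.lookup p y else 0)" for y
    by (simp add: q_def lookup_nc_const_mult lookup_sandwich_middle_matrix[OF p dx])
  define D where "D = (\<lambda>j. 1 \<cdot>\<^sub>m X j + (-1) \<cdot>\<^sub>m Y j)"
  let ?\<rho> = "assign A D (zero_tuple n)"
  have \<rho>: "?\<rho> \<in> sym_tuples n"
    unfolding D_def by (intro assign_in_sym_tuples A affine_in_sym_tuples X Y zero_tuple_in_sym_tuples)
  have "nct q = q"
    by (rule poly_mapping_eqI) (simp add: lookup_nct q lookup_rev_if_nct_eq[OF sym])
  then have tr: "transpose_mat (nc_eval n ?\<rho> q) = nc_eval n ?\<rho> q"
    by (simp add: nc_eval_nct[OF \<rho>, symmetric])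
  have nonneg: "0 \<le> scalar_prod (nc_eval n ?\<rho> q *\<^sub>v \<xi>) \<xi>" if \<xi>: "\<xi> \<in> carrier_vec n" for \<xi>
  proof -
    let ?e = "\<lambda>w. word_eval n ?\<rho> (map h_to_x w) *\<^sub>v \<xi>"
    have e: "?e w \<in> carrier_vec n" for w
      by (rule mult_mat_vec_carrier[OF word_eval_carrier[OF \<rho>] \<xi>])
    have Z: "nc_eval n ?\<rho> (?Z u w) = eval_ax n (?Z u w) A (zero_tuple n)" for u w
      using middle_matrix_in_ncpolys_avars[OF p dx] by (rule nc_eval_cong) auto
    have fin: "finite ?I"
      by (simp add: border0_eq_border finite_border)
    have "scalar_prod (nc_eval n ?\<rho> q *\<^sub>v \<xi>) \<xi> =
        1/2 * (\<Sum>u\<in>?I. \<Sum>w\<in>?I. scalar_prod (nc_eval n ?\<rho> (?Z u w) *\<^sub>v ?e w) (?e u))"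
      unfolding q_def nc_eval_form_const_mult[OF \<rho> \<xi> \<xi>] nc_eval_form_sandwich[OF \<rho> \<xi> fin] ..
    moreover have "0 \<le> (\<Sum>u\<in>?I. \<Sum>w\<in>?I. scalar_prod (nc_eval n ?\<rho> (?Z u w) *\<^sub>v ?e w) (?e u))"
      unfolding Z using psd[unfolded block_psd_def, THEN conjunct2, rule_format, of ?e] e by simp
    ultimately show ?thesis by simp
  qed
  have "psd n ((t * (1 - t)) \<cdot>\<^sub>m nc_eval n ?\<rho> q)"
    unfolding psd_def
  proof (intro conjI ballI)
    show "transpose_mat ((t * (1 - t)) \<cdot>\<^sub>m nc_eval n ?\<rho> q) = (t * (1 - t)) \<cdot>\<^sub>m nc_eval n ?\<rho> q"
    proof (rule eq_matI)
      fix i k assume "i < dim_row ((t * (1 - t)) \<cdot>\<^sub>m nc_eval n ?\<rho> q)"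
        "k < dim_col ((t * (1 - t)) \<cdot>\<^sub>m nc_eval n ?\<rho> q)"
      then have ik: "i < n" "k < n" by simp_all
      then have "nc_eval n ?\<rho> q $$ (k, i) = nc_eval n ?\<rho> q $$ (i, k)"
        using arg_cong[OF tr, of "\<lambda>M. M $$ (i, k)"] by simp
      with ik show "transpose_mat ((t * (1 - t)) \<cdot>\<^sub>m nc_eval n ?\<rho> q) $$ (i, k) =
          ((t * (1 - t)) \<cdot>\<^sub>m nc_eval n ?\<rho> q) $$ (i, k)"
        by simp
    qed simp_all
    fix \<xi> :: "real vec" assume \<xi>: "\<xi> \<in> carrier_vec n"
    have "scalar_prod (((t * (1 - t)) \<cdot>\<^sub>m nc_eval n ?\<rho> q) *\<^sub>v \<xi>) \<xi> =
        t * (1 - t) * scalar_prod (nc_eval n ?\<rho> q *\<^sub>v \<xi>) \<xi>"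
      using \<xi> by (simp add: scalar_prod_mult_mat_vec[of _ n n] sum_distrib_left ac_simps)
    then show "0 \<le> scalar_prod (((t * (1 - t)) \<cdot>\<^sub>m nc_eval n ?\<rho> q) *\<^sub>v \<xi>) \<xi>"
      using t nonneg[OF \<xi>] by simp
  qed simp
  then show "psd n (t \<cdot>\<^sub>m eval_ax n p A X + (1 - t) \<cdot>\<^sub>m eval_ax n p A Y
      - eval_ax n p A (\<lambda>j. t \<cdot>\<^sub>m X j + (1 - t) \<cdot>\<^sub>m Y j))"
    unfolding nc_eval_convexity_gap[OF A X Y p dx q] D_def .
qed

section \<open>Positive partial Hessians along one vector\<close>

theorem proposition3p1:
  fixes p :: "'g::finite var ncpoly"
    and d d\<^sub>a d\<^sub>x n :: nat
    and v :: "real vec"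
    and chi :: "'g \<Rightarrow> real mat"
    and U :: "('g \<Rightarrow> real mat) set"
  assumes "p \<in> ncpolys (avars \<union> xvars)"
    and "nct p = p"
    and "d = pdeg UNIV p" and "d\<^sub>a = pdeg avars p" and "d\<^sub>x = pdeg xvars p"
    and "n \<ge> (\<Sum>j=0..d. CARD('g) ^ j)"
    and "v \<in> carrier_vec n"
    and "chi \<in> sym_tuples n"
    and "open_tuples n U" and "U \<noteq> {}"
    and "\<forall>A\<in>U. lin_indep_family n (border_monos d\<^sub>a d\<^sub>x)
           (\<lambda>m. word_eval n (assign A chi (zero_tuple n)) m *\<^sub>v v)"
    and "\<forall>l>0. \<forall>A\<in>U. \<forall>H\<in>sym_tuples (n * l).
           0 \<le> scalar_prod
             (nc_eval (n * l) (assign (ampl l A) (ampl l chi) H) (partial_hessian p) *\<^sub>v ampl_vec l v)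
             (ampl_vec l v)"
  shows "pdeg xvars p \<le> 2 \<and>
    ((\<forall>u\<in>border0 d\<^sub>a. \<forall>w\<in>border0 d\<^sub>a. middle_matrix p u w \<in> ncpolys avars) \<and>
      partial_hessian p = sandwich (border0 d\<^sub>a) V_h (middle_matrix p)) \<and>
    (\<forall>A\<in>U. block_psd n (border0 d\<^sub>a)
      (\<lambda>u w. eval_ax n (middle_matrix p u w) A (zero_tuple n))) \<and>
    (\<exists>L\<in>ncpolys (avars \<union> xvars). nct L = L \<and> pdeg xvars L \<le> 1 \<and>
      p = nc_const (1/2) * sandwich (border0 d\<^sub>a) V_x (middle_matrix p) + L) \<and>
    (\<forall>A\<in>U. globally_convex n (eval_ax n p A))"
proof -
  note p = assms(1) and sym = assms(2) and chi = assms(8) and U = assms(9,10)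
  have U_sub: "U \<subseteq> sym_tuples n"
    using U(1) by (simp add: open_tuples_def)
  let ?Z = "middle_matrix p" and ?B = "border (pdeg avars p) (pdeg xvars p) :: 'g var list set"
  let ?I = "border0 (pdeg avars p) :: 'g var list set"
  have psd_chi: "block_psd n ?B (\<lambda>u w. eval_ax n (?Z u w) A chi)" if A: "A \<in> U" for A
  proof (rule block_psd_if_doubled_form_nonneg)
    fix H :: "'g \<Rightarrow> real mat" assume "H \<in> sym_tuples (n * 2)"
    moreover have "partial_hessian p = sandwich ?B nc_mono ?Z"
      using is_middle_matrix_middle_matrix[OF p] by (simp add: is_middle_matrix_def Let_def)
    ultimately show "0 \<le> scalar_prod
        (nc_eval (n * 2) (assign (ampl 2 A) (ampl 2 chi) H) (sandwich ?B nc_mono ?Z)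
          *\<^sub>v ampl_vec 2 v) (ampl_vec 2 v)"
      using assms(12)[rule_format, of 2 A H] A by simp
  qed (use assms A U_sub in \<open>auto intro: middle_matrix_in_ncpolys nct_middle_matrix\<close>)
  have "pdeg UNIV p \<le> n"
  proof -
    have "d + 1 = (\<Sum>j=0..d. 1)"
      by simp
    also have "\<dots> \<le> (\<Sum>j=0..d. CARD('g) ^ j)"
      by (intro sum_mono) simp
    finally show ?thesis
      using assms(3,6) by simp
  qed
  then have dx: "pdeg xvars p \<le> 2"
    by (rule pdeg_xvars_le_2_if_block_psd[OF p _ U chi psd_chi])
  have avars: "?Z u w \<in> ncpolys avars" for u w
    by (rule middle_matrix_in_ncpolys_avars[OF p dx])
  have psd_0: "block_psd n ?I (\<lambda>u w. eval_ax n (?Z u w) A (zero_tuple n))" if A: "A \<in> U" for A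
  proof -
    have "eval_ax n (?Z u w) A chi = eval_ax n (?Z u w) A (zero_tuple n)" for u w
      using avars by (rule nc_eval_cong) auto
    with psd_chi[OF A] have "block_psd n ?B (\<lambda>u w. eval_ax n (?Z u w) A (zero_tuple n))"
      by simp
    then show ?thesis
      by (rule block_psd_superset)
        (use border_mono[OF dx] in \<open>auto simp: border0_eq_border finite_border
          middle_matrix_eq_0[OF p] nc_eval_zero\<close>)
  qed
  define Q where "Q = nc_const (1/2) * sandwich ?I (\<lambda>w. nc_mono (map h_to_x w)) ?Z"
  define L where "L = p - Q"
  have L: "Poly_Mapping.lookup L y = (if wdeg xvars y = 2 then 0 else Poly_Mapping.lookup p y)" for y
    by (simp add: L_def Q_def lookup_minus lookup_nc_const_mult lookup_sandwich_middle_matrix[OF p dx])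
  have keys_L: "y \<in> Poly_Mapping.keys p \<and> wdeg xvars y \<noteq> 2" if "y \<in> Poly_Mapping.keys L" for y
    using that by (auto simp: in_keys_iff L split: if_splits)
  have "L \<in> ncpolys (avars \<union> xvars)"
    using p keys_L unfolding ncpolys_def by blast
  moreover have "nct L = L"
    by (rule poly_mapping_eqI) (simp add: lookup_nct L lookup_rev_if_nct_eq[OF sym])
  moreover have "pdeg xvars L \<le> 1"
  proof (rule pdeg_leI)
    fix y assume "y \<in> Poly_Mapping.keys L"
    with keys_L wdeg_le_pdeg[of y p xvars] dx show "wdeg xvars y \<le> 1"
      by fastforce
  qed
  moreover have "p = Q + L"
    by (simp add: L_def)
  ultimately have L_ex: "\<exists>L\<in>ncpolys (avars \<union> xvars). nct L = L \<and> pdeg xvars L \<le> 1 \<and> p = Q + L"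
    by blast
  have "globally_convex n (eval_ax n p A)" if "A \<in> U" for A
    using p sym dx subsetD[OF U_sub that] psd_0[OF that] by (rule globally_convex_if_block_psd)
  then show ?thesis
    using dx avars psd_0 L_ex partial_hessian_eq_sandwich_border0[OF p dx]
    unfolding assms(4) Q_def by blast
qed

end
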